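(* For any integers $k>l\ge 2$, as $n\to\infty$, $$ex(n,C_{2l+1},\{C_3,C_4,\dots,C_{2l}\}\cup\{C_{2k}\})=\Omega(n^{1+\frac{1}{2k+1}})\quad\text{and}\quad ex(n,C_{2l+1},\{C_3,C_4,\dots,C_{2l}\}\cup\{C_{2k}\})=O(n^{1+\frac{l}{l+1}}).$$
   Context: $C_k$ denotes the cycle with $k$ vertices. For a graph $H$ and a family of graphs $\mathcal F$, $ex(n,H,\mathcal F)$ is the maximum number of subgraphs isomorphic to $H$ in an $n$-vertex graph containing no member of $\mathcal F$ as a subgraph. *)

theory Defs
  imports Complex_Main "HOL-Library.Landau_Symbols"
begin

definition simple_graph :: "nat \<Rightarrow> nat set set \<Rightarrow> bool" where
  "simple_graph n E \<longleftrightarrow> E \<subseteq> {{u, v} | u v. u \<noteq> v \<and> u < n \<and> v < n}"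

definition is_cycle :: "nat set set \<Rightarrow> nat \<Rightarrow> nat list \<Rightarrow> bool" where
  "is_cycle E k vs \<longleftrightarrow> k \<ge> 3 \<and> length vs = k \<and> distinct vs \<and>
     (\<forall>i<k. {vs ! i, vs ! ((i + 1) mod k)} \<in> E)"

text \<open>Edge set of the cycle traversed by vs; a copy of C_k is determined by its edge set.\<close>
definition cycle_edges :: "nat \<Rightarrow> nat list \<Rightarrow> nat set set" where
  "cycle_edges k vs = {{vs ! i, vs ! ((i + 1) mod k)} | i. i < k}"

definition contains_cycle :: "nat set set \<Rightarrow> nat \<Rightarrow> bool" where
  "contains_cycle E k \<longleftrightarrow> (\<exists>vs. is_cycle E k vs)"

definition count_cycles :: "nat set set \<Rightarrow> nat \<Rightarrow> nat" where
  "count_cycles E k = card {cycle_edges k vs | vs. is_cycle E k vs}"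

definition ex_cycle :: "nat \<Rightarrow> nat \<Rightarrow> nat set \<Rightarrow> nat" where
  "ex_cycle n h F = Max {count_cycles E h | E. simple_graph n E \<and> (\<forall>j\<in>F. \<not> contains_cycle E j)}"

end

theory Submission
  imports Defs
begin

text \<open>
  Upper bound. In a graph of girth greater than $2l$ a non-backtracking walk with at most $2l$
  edges is a path, and two such walks with the same ends and total length at most $2l$ coincide.
  Hence the $l$-paths from a vertex $v$ form a tree. If the last edges of a set of
  $(l+1)$-paths from $v$ were dense, a long alternating path in them, with end points in different
  branches of the tree, would close up to a $C_{2k}$; so such a set has size linear in the number
  of its end points. A copy of $C_{2l+1}$ through $u$ is encoded by an edge between end points of
  $l$-paths from $u$, and even by those $l$-paths that avoid a prescribed neighbour $v$. So if
  every vertex lies on more than $M$ copies, then a vertex $v$ of maximal degree $\Delta$ starts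
  at least of order $\Delta M$ paths with $l+1$ edges, and at most $O(n)$ by sparsity, while
  $M = O(\Delta^l)$. Therefore $M = O(n^{l/(l+1)})$, and one deletes vertices one at a time.

  Lower bound. Take an edge-maximal graph without the forbidden cycles, of maximal degree at most
  $D$ and with $|E|$ at most $2l+1$ times the number of copies of $C_{2l+1}$. A new $(2l+1)$-cycle
  can be added through vertices of degree at most $D - 2$ at pairwise distance greater than $2k$,
  so all but $(2l+1)(D+1)^{2k}$ vertices have degree at least $D - 1$; take $D$ close to
  $n^{1/(2k+1)}$.
\<close>

section \<open>Non-backtracking walks\<close>

abbreviation walk :: "nat set set \<Rightarrow> nat list \<Rightarrow> bool" where
  "walk E \<equiv> successively (\<lambda>x y. {x, y} \<in> E)"

text \<open>Only immediate reversals are forbidden. This condition is local and so survives gluing,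
  while large girth later upgrades such walks to paths.\<close>

definition nb_walk :: "nat set set \<Rightarrow> nat list \<Rightarrow> bool" where
  "nb_walk E p \<longleftrightarrow> walk E p \<and> (\<forall>i. Suc (Suc i) < length p \<longrightarrow> p ! i \<noteq> p ! Suc (Suc i))"

text \<open>Trades the modular indices for a list walk plus one closing edge, so that facts about
  appending, reversing and rotating lists apply.\<close>

lemma is_cycle_iff_walk:
  "is_cycle E k vs \<longleftrightarrow>
     3 \<le> k \<and> length vs = k \<and> distinct vs \<and> walk E vs \<and> {last vs, hd vs} \<in> E"
proof -
  have "(\<forall>i<k. {vs ! i, vs ! ((i + 1) mod k)} \<in> E) \<longleftrightarrow> walk E vs \<and> {last vs, hd vs} \<in> E"
    if k: "3 \<le> k" "length vs = k"
  proof -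
    obtain m where m: "k = Suc m" using k(1) by (cases k) auto
    have "vs \<noteq> []" using k by auto
    then have ends: "last vs = vs ! m" "hd vs = vs ! 0"
      using k m by (auto simp: last_conv_nth hd_conv_nth)
    have "(\<forall>i<k. {vs ! i, vs ! ((i + 1) mod k)} \<in> E) \<longleftrightarrow>
        {vs ! m, vs ! 0} \<in> E \<and> (\<forall>i<m. {vs ! i, vs ! Suc i} \<in> E)"
    proof -
      have "Suc i mod Suc m = Suc i" if "i < m" for i using that by simp
      then show ?thesis unfolding m All_less_Suc by auto
    qed
    then show ?thesis
      using k m ends by (auto simp: successively_conv_nth)
  qed
  then show ?thesis unfolding is_cycle_def by blast
qed

lemma walk_rev [simp]: "walk E (rev p) \<longleftrightarrow> walk E p"
  by (simp add: insert_commute)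

lemma walk_take: "walk E p \<Longrightarrow> walk E (take i p)"
  by (metis append_take_drop_id successively_append_iff)

lemma walk_drop: "walk E p \<Longrightarrow> walk E (drop i p)"
  by (metis append_take_drop_id successively_append_iff)

lemma nb_walk_if_distinct: "walk E p \<Longrightarrow> distinct p \<Longrightarrow> nb_walk E p"
  by (auto simp: nb_walk_def nth_eq_iff_index_eq)

lemma nb_walk_take: "nb_walk E p \<Longrightarrow> nb_walk E (take i p)"
  by (auto simp: nb_walk_def walk_take)

lemma nb_walk_Cons:
  "nb_walk E (x # p) \<longleftrightarrow>
     p = [] \<or> {x, hd p} \<in> E \<and> nb_walk E p \<and> (2 \<le> length p \<longrightarrow> x \<noteq> p ! 1)"
proof (cases p)
  case (Cons y q)
  have *: "(\<forall>i. Suc (Suc i) < length (x # p) \<longrightarrow> (x # p) ! i \<noteq> (x # p) ! Suc (Suc i)) \<longleftrightarrow>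
     (2 \<le> length p \<longrightarrow> x \<noteq> p ! 1) \<and> (\<forall>i. Suc (Suc i) < length p \<longrightarrow> p ! i \<noteq> p ! Suc (Suc i))"
    (is "?L \<longleftrightarrow> ?R")
  proof
    assume L: ?L
    show ?R
    proof (intro conjI impI allI)
      show "x \<noteq> p ! 1" if "2 \<le> length p" using L[rule_format, of 0] that by auto
      show "p ! i \<noteq> p ! Suc (Suc i)" if "Suc (Suc i) < length p" for i
        using L[rule_format, of "Suc i"] that by auto
    qed
  next
    assume R: ?R
    show ?L
    proof (intro allI impI)
      fix i assume "Suc (Suc i) < length (x # p)"
      then show "(x # p) ! i \<noteq> (x # p) ! Suc (Suc i)" using R by (cases i) auto
    qed
  qed
  show ?thesis unfolding nb_walk_def * using Cons by (auto simp: successively_Cons)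
qed (simp add: nb_walk_def)

lemma nb_walk_tl: "nb_walk E p \<Longrightarrow> nb_walk E (tl p)"
  by (cases p) (auto simp: nb_walk_Cons, simp add: nb_walk_def)

lemma nb_walk_rev [simp]: "nb_walk E (rev p) \<longleftrightarrow> nb_walk E p"
proof -
  have "nb_walk E (rev p)" if "nb_walk E p" for p
    unfolding nb_walk_def
  proof (intro conjI allI impI)
    show "walk E (rev p)" using that by (simp only: walk_rev nb_walk_def)
    fix i assume i: "Suc (Suc i) < length (rev p)"
    define j where "j = length p - Suc (Suc (Suc i))"
    have "rev p ! i = p ! Suc (Suc j)" "rev p ! Suc (Suc i) = p ! j" "Suc (Suc j) < length p"
      using i by (auto simp: rev_nth j_def intro: arg_cong[of _ _ "(!) p"])
    then show "rev p ! i \<noteq> rev p ! Suc (Suc i)" using that by (metis nb_walk_def)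
  qed
  from this[of p] this[of "rev p"] show ?thesis by auto
qed

text \<open>Backtracking in the glued walk can only arise at the joint \<open>v\<close>.\<close>

lemma nb_walk_append:
  "nb_walk E (xs @ [v]) \<Longrightarrow> nb_walk E (v # ys) \<Longrightarrow>
   (xs \<noteq> [] \<Longrightarrow> ys \<noteq> [] \<Longrightarrow> last xs \<noteq> hd ys) \<Longrightarrow> nb_walk E (xs @ v # ys)"
proof (induction xs)
  case (Cons x xs)
  have "nb_walk E (xs @ [v])" using Cons.prems(1) by (simp add: nb_walk_Cons)
  then have "nb_walk E (xs @ v # ys)"
    by (rule Cons.IH) (use Cons.prems in \<open>auto\<close>)
  moreover have "{x, hd (xs @ v # ys)} \<in> E"
    using Cons.prems(1) by (cases xs) (auto simp: nb_walk_Cons)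
  moreover have "x \<noteq> (xs @ v # ys) ! 1" if "2 \<le> length (xs @ v # ys)"
  proof (cases xs)
    case Nil
    then show ?thesis using Cons.prems(3) that by (cases ys) auto
  next
    case (Cons z zs)
    then show ?thesis using Cons.prems(1) by (cases zs) (auto simp: nb_walk_Cons)
  qed
  ultimately show ?case by (simp add: nb_walk_Cons)
qed simp

text \<open>By induction the tail is distinct, so if the head \<open>x\<close> recurs, the segment
  up to its first recurrence closes to a cycle of length at most \<open>g\<close>.\<close>

lemma nb_walk_distinct:
  assumes noloop: "\<And>x. {x} \<notin> E"
    and girth: "\<And>j. 3 \<le> j \<Longrightarrow> j \<le> g \<Longrightarrow> \<not> contains_cycle E j"
    and "nb_walk E p" "length p \<le> Suc g"
  shows "distinct p"
  using assms(3,4)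
proof (induction p)
  case (Cons x p)
  have dp: "distinct p" using Cons by (auto simp: nb_walk_Cons)
  show ?case
  proof (rule ccontr)
    assume "\<not> distinct (x # p)"
    then have "x \<in> set p" using dp by simp
    then obtain ys zs where p: "p = ys @ x # zs" by (meson split_list)
    have nb: "nb_walk E (x # ys @ x # zs)" using Cons.prems p by simp
    \<comment> \<open>With no vertex between the two occurrences of \<open>x\<close> there would be
      a loop, with a single one the walk would backtrack.\<close>
    have "length ys \<ge> 2"
    proof (rule ccontr)
      assume "\<not> ?thesis"
      then consider "ys = []" | y where "ys = [y]"
        by (cases ys; cases "tl ys") auto
      then show False
        by cases (use nb noloop[of x] in \<open>auto simp: nb_walk_Cons\<close>)
    qed
    have "distinct (x # ys)" using dp p by auto
    have "walk E ((x # ys) @ (x # zs))" using nb by (simp add: nb_walk_def)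
    then have "walk E (x # ys)" "{last (x # ys), x} \<in> E"
      unfolding successively_append_iff by auto
    with \<open>distinct (x # ys)\<close> have "is_cycle E (Suc (length ys)) (x # ys)"
      using \<open>length ys \<ge> 2\<close> unfolding is_cycle_iff_walk by simp
    moreover have "Suc (length ys) \<le> g" using Cons.prems(2) p by auto
    ultimately show False using girth[of "Suc (length ys)"] \<open>length ys \<ge> 2\<close>
      unfolding contains_cycle_def by auto
  qed
qed simp

text \<open>Common first steps are stripped by induction. Once the walks part, reversing one and
  appending the other gives a non-backtracking walk with at most \<open>g + 1\<close> vertices; it
  is distinct, yet both its ends are the common last vertex.\<close>

lemma nb_walk_unique:
  assumes noloop: "\<And>x. {x} \<notin> E"
    and girth: "\<And>j. 3 \<le> j \<Longrightarrow> j \<le> g \<Longrightarrow> \<not> contains_cycle E j"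
  shows "nb_walk E p \<Longrightarrow> nb_walk E q \<Longrightarrow> p \<noteq> [] \<Longrightarrow> q \<noteq> [] \<Longrightarrow> hd p = hd q \<Longrightarrow>
    last p = last q \<Longrightarrow> length p + length q \<le> Suc (Suc g) \<Longrightarrow> p = q"
proof (induction p arbitrary: q)
  case (Cons v p)
  obtain q' where q: "q = v # q'" using Cons.prems by (cases q) auto
  have d: "distinct (v # p)" "distinct (v # q')"
    using nb_walk_distinct[OF noloop girth] Cons.prems q by (auto simp del: distinct.simps)
  show ?case
  proof (cases "p = [] \<or> q' = []")
    \<comment> \<open>One walk is the single vertex \<open>v\<close>, so the other one ends where it
      starts and, being distinct, is trivial too.\<close>
    case True
    then show ?thesis using d q Cons.prems by (auto split: if_splits)
  next
    case False
    show ?thesis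
    proof (cases "hd p = hd q'")
      case True
      then show ?thesis using Cons.IH[of q'] Cons.prems False q by (auto simp: nb_walk_Cons)
    next
      case hd: False
      have "nb_walk E (rev p @ [v])" using Cons.prems(1) nb_walk_rev[of E "v # p"] by simp
      then have "nb_walk E (rev p @ v # q')"
        by (rule nb_walk_append) (use Cons.prems(2) q hd False in \<open>auto simp: last_rev\<close>)
      then have "distinct (rev p @ v # q')"
        using Cons.prems(7) q by (intro nb_walk_distinct[OF noloop girth]) auto
      moreover have "last p \<in> set p" "last p \<in> set q'"
        using False Cons.prems(6) q by (auto, metis last_in_set)
      ultimately show ?thesis by auto
    qed
  qed
qed simp

section \<open>Graphs of girth greater than $2l$ without $C_{2k}$\<close>

text \<open>Each \<open>q\<close> is seen as an edge joining \<open>f q\<close> to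
  \<open>g q\<close> in a bipartite multigraph. As for subgraphs of large minimum degree, deleting
  an end with at most \<open>K\<close> edges preserves the density inequality, so the process stops
  at a nonempty set.\<close>

lemma exists_dense_subset:
  fixes f g :: "'a \<Rightarrow> 'b"
  assumes "finite Q" "card Q > K * (card (f ` Q) + card (g ` Q))"
  shows "\<exists>Q'\<subseteq>Q. Q' \<noteq> {} \<and> (\<forall>q\<in>Q'. card {q'\<in>Q'. f q' = f q} > K \<and> card {q'\<in>Q'. g q' = g q} > K)"
  using assms
proof (induction Q rule: finite_psubset_induct)
  case (psubset Q)
  \<comment> \<open>\<open>h\<close> is the side of the small fibre and \<open>h'\<close> the other
    one, so both sides are treated at once.\<close>
  have step: ?case
    if q: "q \<in> Q" and small: "card {q'\<in>Q. h q' = h q} \<le> K"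
      and h: "h = f \<and> h' = g \<or> h = g \<and> h' = f" for q h h'
  proof -
    define R where "R = Q - {q'\<in>Q. h q' = h q}"
    have R: "R \<subset> Q" using q by (auto simp: R_def)
    have "card (h ` R) \<le> card (h ` Q - {h q})"
      using psubset.hyps by (intro card_mono) (auto simp: R_def)
    then have hR: "card (h ` R) + 1 \<le> card (h ` Q)"
      using q psubset.hyps card_Suc_Diff1[of "h ` Q" "h q"] by auto
    have h'R: "card (h' ` R) \<le> card (h' ` Q)"
      using psubset.hyps R by (intro card_mono) auto
    have "K * (card (h ` R) + card (h' ` R)) + K = K * (card (h ` R) + 1 + card (h' ` R))"
      by (simp add: algebra_simps)
    also have "\<dots> \<le> K * (card (h ` Q) + card (h' ` Q))"
      using hR h'R by (intro mult_left_mono) auto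
    also have "\<dots> < card Q" using h psubset.prems by (auto simp: add.commute)
    also have "card Q \<le> card R + K"
      using small psubset.hyps unfolding R_def by (subst card_Diff_subset) auto
    finally have "K * (card (f ` R) + card (g ` R)) < card R"
      using h by (auto simp: add.commute)
    from psubset.IH[OF R this] show ?case using R by blast
  qed
  show ?case
  proof (cases "\<exists>q\<in>Q. card {q'\<in>Q. f q' = f q} \<le> K \<or> card {q'\<in>Q. g q' = g q} \<le> K")
    case True
    then show ?thesis using step by blast
  next
    case False
    then show ?thesis using psubset.prems by (intro exI[of _ Q]) (auto simp: not_le)
  qed
qed

locale girth_graph =
  fixes E :: "nat set set" and n k l :: nat
  assumes simple: "simple_graph n E"
    and l2: "l \<ge> 2" and kl: "k > l"
    and no_short: "\<And>j. 3 \<le> j \<Longrightarrow> j \<le> 2 * l \<Longrightarrow> \<not> contains_cycle E j"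
    and no_2k: "\<not> contains_cycle E (2 * k)"
begin

lemma noloop: "{x} \<notin> E"
  using simple by (auto simp: simple_graph_def doubleton_eq_iff)

lemma edge_less: "{x, y} \<in> E \<Longrightarrow> x < n \<and> y < n"
  using simple by (auto simp: simple_graph_def doubleton_eq_iff)

section \<open>The tree of non-backtracking walks from a vertex\<close>

definition paths :: "nat \<Rightarrow> nat \<Rightarrow> nat list set" where
  "paths v j = {p. nb_walk E p \<and> length p = Suc j \<and> hd p = v}"

definition nbrs :: "nat \<Rightarrow> nat set" where
  "nbrs v = {u. {u, v} \<in> E}"

lemma finite_nbrs: "finite (nbrs v)"
  by (rule finite_subset[of _ "{..<n}"]) (auto simp: nbrs_def dest: edge_less)

text \<open>Index 0 is left out because the one-vertex walk \<open>[v]\<close> belongs to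
  \<open>paths v 0\<close> for every number \<open>v\<close>, even beyond \<open>n\<close>.\<close>

lemma nth_paths_less: "p \<in> paths v j \<Longrightarrow> 0 < i \<Longrightarrow> i \<le> j \<Longrightarrow> p ! i < n"
  using successively_nth[of "\<lambda>x y. {x, y} \<in> E" p "i - 1"] edge_less
  by (auto simp: paths_def nb_walk_def)

lemma finite_paths: "finite (paths v j)"
proof (rule finite_subset)
  show "paths v j \<subseteq> {p. set p \<subseteq> insert v {..<n} \<and> length p = Suc j}"
  proof
    fix p assume p: "p \<in> paths v j"
    have "x \<in> insert v {..<n}" if x: "x \<in> set p" for x
    proof -
      obtain i where "i < length p" "x = p ! i" using x by (auto simp: in_set_conv_nth)
      then show ?thesis using p nth_paths_less[OF p, of i]
        by (cases i) (auto simp: paths_def hd_conv_nth)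
    qed
    then show "p \<in> {p. set p \<subseteq> insert v {..<n} \<and> length p = Suc j}" using p by (auto simp: paths_def)
  qed
qed (simp add: finite_lists_length_eq)

lemma walk_unique:
  "nb_walk E p \<Longrightarrow> nb_walk E q \<Longrightarrow> p \<noteq> [] \<Longrightarrow> q \<noteq> [] \<Longrightarrow> hd p = hd q \<Longrightarrow>
    last p = last q \<Longrightarrow> length p + length q \<le> 2 * l + 2 \<Longrightarrow> p = q"
  using nb_walk_unique[OF noloop no_short, of "2 * l" p q] by auto

text \<open>The two initial segments have \<open>i + j + 2\<close> vertices in total, within the
  range of uniqueness. Thus a vertex near the root has one depth and one route from the root, which
  is the tree structure.\<close>

lemma paths_meet:
  assumes "p \<in> paths v s" "q \<in> paths v t" "p ! i = q ! j" "i \<le> s" "j \<le> t" "i + j \<le> 2 * l"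
  shows "i = j \<and> take (Suc i) p = take (Suc i) q"
proof -
  have "take (Suc i) p = take (Suc j) q"
  proof (rule walk_unique)
    show "last (take (Suc i) p) = last (take (Suc j) q)"
      using assms by (simp add: paths_def take_Suc_conv_app_nth)
    show "hd (take (Suc i) p) = hd (take (Suc j) q)" using assms by (simp add: paths_def)
  qed (use assms in \<open>auto simp: paths_def intro: nb_walk_take\<close>)
  moreover from this have "length (take (Suc i) p) = length (take (Suc j) q)" by simp
  then have "i = j" using assms by (simp add: paths_def)
  ultimately show ?thesis by simp
qed

text \<open>The second vertex of a path from \<open>v\<close> names its branch of the tree of paths; by the next two facts
  the last edge determines the path, and paths with a common end lie in different branches.\<close>

lemma paths_inj_last2:
  assumes "p \<in> paths v (Suc l)" "q \<in> paths v (Suc l)" "p ! l = q ! l" "p ! Suc l = q ! Suc l"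
  shows "p = q"
proof -
  have "take (Suc l) p = take (Suc l) q" using paths_meet[OF assms(1,2,3)] by auto
  moreover have "p = take (Suc l) p @ [p ! Suc l]" "q = take (Suc l) q @ [q ! Suc l]"
    using assms(1,2) by (auto simp: paths_def take_Suc_conv_app_nth[symmetric])
  ultimately show ?thesis using assms(4) by metis
qed

lemma paths_inj_branch:
  assumes "p \<in> paths v (Suc l)" "q \<in> paths v (Suc l)" "p ! 1 = q ! 1" "p ! Suc l = q ! Suc l"
  shows "p = q"
proof -
  obtain p' q' where pq: "p = v # p'" "q = v # q'" using assms(1,2)
    by (cases p; cases q) (auto simp: paths_def)
  have "p' = q'"
  proof (rule walk_unique)
    have len: "length p' = Suc l" "length q' = Suc l" using assms pq by (auto simp: paths_def)
    then show ne: "p' \<noteq> []" "q' \<noteq> []" by auto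
    show "hd p' = hd q'" "last p' = last q'"
      using assms(3,4) pq len ne by (auto simp: hd_conv_nth last_conv_nth)
    show "nb_walk E p'" "nb_walk E q'" "length p' + length q' \<le> 2 * l + 2"
      using assms pq by (auto simp: paths_def nb_walk_Cons)
  qed
  then show ?thesis using pq by simp
qed

text \<open>The path zigzags between ends at depth \<open>l\<close> and ends at depth
  \<open>l + 1\<close>, each round adding one of either kind. Density leaves room to avoid used
  vertices and, in addition, the branch of \<open>q0\<close>.\<close>

lemma alternating_path:
  assumes Q: "Q \<subseteq> paths v (Suc l)" and q0: "q0 \<in> Q"
    and dense: "\<And>q. q \<in> Q \<Longrightarrow> card {q'\<in>Q. q' ! l = q ! l} > 2 * k"
      "\<And>q. q \<in> Q \<Longrightarrow> card {q'\<in>Q. q' ! Suc l = q ! Suc l} > 2 * k"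
  shows "j \<le> k - l \<Longrightarrow> \<exists>zs q. length zs = 2 * j + 1 \<and> distinct zs \<and> walk E zs \<and> hd zs = q0 ! l \<and>
     q \<in> Q \<and> last zs = q ! l \<and> (j > 0 \<longrightarrow> q ! 1 \<noteq> q0 ! 1) \<and>
     (\<forall>z\<in>set zs. \<exists>q'\<in>Q. z = q' ! l \<or> z = q' ! Suc l)"
proof (induction j)
  case 0
  show ?case using q0 by (intro exI[of _ "[q0 ! l]"] exI[of _ q0]) auto
next
  case (Suc j)
  then obtain zs q where zs: "length zs = 2 * j + 1" "distinct zs" "walk E zs" "hd zs = q0 ! l"
    "q \<in> Q" "last zs = q ! l" "\<And>z. z \<in> set zs \<Longrightarrow> \<exists>q'\<in>Q. z = q' ! l \<or> z = q' ! Suc l"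
    by auto
  have fin: "finite Q" using Q finite_paths finite_subset by blast
  have edge: "{q ! l, q ! Suc l} \<in> E" if "q \<in> Q" for q
    using that Q successively_nth[of "\<lambda>x y. {x, y} \<in> E" q l] by (auto simp: paths_def nb_walk_def)
  \<comment> \<open>Members of this fibre have different last vertices, and there are more of them
    than vertices in \<open>zs\<close>.\<close>
  have "\<exists>r\<in>{q'\<in>Q. q' ! l = q ! l}. r ! Suc l \<notin> set zs"
  proof (rule ccontr)
    assume "\<not> ?thesis"
    then have "card {q'\<in>Q. q' ! l = q ! l} \<le> card (set zs)"
      using Q by (intro card_inj_on_le[of "\<lambda>r. r ! Suc l"] inj_onI) (auto intro: paths_inj_last2)
    then show False using dense(1)[OF zs(5)] zs(1) card_length[of zs] Suc.prems by simp
  qed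
  then obtain r where r: "r \<in> Q" "r ! l = q ! l" "r ! Suc l \<notin> set zs" by auto
  define y where "y = r ! Suc l"
  \<comment> \<open>At most \<open>2 * j + 2\<close> candidates hit a used vertex and at most one
    lies in the branch of \<open>q0\<close>. Since \<open>Suc j \<le> k - l\<close> and
    \<open>l \<ge> 2\<close>, fewer than the available number are excluded.\<close>
  have "\<exists>t\<in>{q'\<in>Q. q' ! Suc l = y}. t ! l \<notin> set (y # zs) \<and> t ! 1 \<noteq> q0 ! 1"
  proof (rule ccontr)
    let ?T = "{q'\<in>Q. q' ! Suc l = y}"
    assume "\<not> ?thesis"
    then have *: "?T \<subseteq> {t\<in>?T. t ! l \<in> set (y # zs)} \<union> {t\<in>?T. t ! 1 = q0 ! 1}" by auto
    have "card {t\<in>?T. t ! l \<in> set (y # zs)} \<le> card (set (y # zs))"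
      using Q by (intro card_inj_on_le[of "\<lambda>r. r ! l"] inj_onI) (auto intro: paths_inj_last2)
    also have "\<dots> \<le> 2 * j + 2" using card_length[of "y # zs"] zs(1) by simp
    finally have 1: "card {t\<in>?T. t ! l \<in> set (y # zs)} \<le> 2 * j + 2" .
    have 2: "card {t\<in>?T. t ! 1 = q0 ! 1} \<le> card {q0 ! 1}"
      using Q by (intro card_inj_on_le[of "\<lambda>r. r ! 1"] inj_onI) (auto intro: paths_inj_branch)
    have "card ?T \<le> card ({t\<in>?T. t ! l \<in> set (y # zs)} \<union> {t\<in>?T. t ! 1 = q0 ! 1})"
      using fin by (intro card_mono[OF _ *]) auto
    also have "\<dots> \<le> 2 * j + 2 + 1"
      using 1 2 by (intro order_trans[OF card_Un_le]) auto
    finally show False using dense(2)[OF r(1)] Suc.prems l2 unfolding y_def by simp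
  qed
  then obtain t where t: "t \<in> Q" "t ! Suc l = y" "t ! l \<notin> set (y # zs)" "t ! 1 \<noteq> q0 ! 1"
    by auto
  have "walk E (zs @ [y, t ! l])"
    using zs(1,3,6) edge[OF r(1)] edge[OF t(1)] r(2) t(2) y_def
    by (auto simp: successively_append_iff insert_commute)
  moreover have "distinct (zs @ [y, t ! l])" using zs(2) r(3) t(3) y_def by auto
  moreover have "\<forall>z\<in>set (zs @ [y, t ! l]). \<exists>q'\<in>Q. z = q' ! l \<or> z = q' ! Suc l"
    using zs(7) r(1) t(1) y_def by auto
  moreover have "hd (zs @ [y, t ! l]) = q0 ! l" using zs(1,4) by (cases zs) auto
  ultimately show ?case using t zs(1)
    by (intro exI[of _ "zs @ [y, t ! l]"] exI[of _ t]) auto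
qed

text \<open>Otherwise a dense part contains an alternating path with \<open>2 * (k - l)\<close>
  edges whose ends lie at depth \<open>l\<close> in different branches. The two tree arcs of length
  \<open>l\<close> back to \<open>v\<close> close it to a cycle of length
  \<open>2 * k\<close>.\<close>

lemma last_step_sparse:
  assumes Q: "Q \<subseteq> paths v (Suc l)"
  shows "card Q \<le> 2 * k * (card ((\<lambda>p. p ! l) ` Q) + card ((\<lambda>p. p ! Suc l) ` Q))"
proof (rule ccontr)
  assume "\<not> ?thesis"
  moreover have "finite Q" using Q finite_paths finite_subset by blast
  ultimately obtain R where R: "R \<subseteq> Q" "R \<noteq> {}"
    and dense: "\<And>q. q \<in> R \<Longrightarrow> card {q'\<in>R. q' ! l = q ! l} > 2 * k"
      "\<And>q. q \<in> R \<Longrightarrow> card {q'\<in>R. q' ! Suc l = q ! Suc l} > 2 * k"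
    using exists_dense_subset[of Q "2 * k" "\<lambda>p. p ! l" "\<lambda>p. p ! Suc l"] by (auto simp: not_le)
  obtain q0 where q0: "q0 \<in> R" using R by blast
  have RP: "R \<subseteq> paths v (Suc l)" using R Q by blast
  obtain zs q where zs: "length zs = 2 * (k - l) + 1" "distinct zs" "walk E zs" "hd zs = q0 ! l"
    "q \<in> R" "last zs = q ! l" "q ! 1 \<noteq> q0 ! 1"
    "\<And>z. z \<in> set zs \<Longrightarrow> \<exists>q'\<in>R. z = q' ! l \<or> z = q' ! Suc l"
    using alternating_path[OF RP q0 dense order.refl] kl by auto
  have q0P: "q0 \<in> paths v (Suc l)" and qP: "q \<in> paths v (Suc l)" using q0 zs(5) RP by auto
  \<comment> \<open>The arc \<open>ps\<close> contains the root and \<open>qs\<close> omits it; both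
    omit their ends at depth \<open>l\<close>, which belong to \<open>zs\<close>. The vertex count
    is \<open>l + (2 * (k - l) + 1) + (l - 1) = 2 * k\<close>.\<close>
  define ps where "ps = take l q0"
  define qs where "qs = rev (drop 1 (take l q))"
  \<comment> \<open>Vertices of \<open>zs\<close> occur at depth \<open>l\<close> or
    \<open>l + 1\<close>. As \<open>i + (l + 1) \<le> 2 * l\<close>, they cannot also occur at a
    depth \<open>i < l\<close>.\<close>
  have avoid: "p ! i \<notin> set zs" if p: "p \<in> R" and i: "i < l" for p i
  proof
    assume "p ! i \<in> set zs"
    then obtain q' where q': "q' \<in> R" "p ! i = q' ! l \<or> p ! i = q' ! Suc l" using zs(8) by blast
    then show False
      using paths_meet[of p v "Suc l" q' "Suc l" i l] paths_meet[of p v "Suc l" q' "Suc l" i "Suc l"]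
        p i RP by auto
  qed
  have set_ps: "set ps = (!) q0 ` {..<l}"
    using q0P by (auto simp: ps_def paths_def nth_image[symmetric] lessThan_atLeast0)
  have set_qs: "set qs = (!) q ` {1..<l}"
  proof -
    have "drop 1 (take l q) = map ((!) q) [1..<l]"
      using qP by (intro nth_equalityI) (auto simp: paths_def)
    then show ?thesis by (simp add: qs_def)
  qed
  have disj: "set ps \<inter> set zs = {}" "set qs \<inter> set zs = {}"
    using avoid q0 zs(5) by (auto simp: set_ps set_qs)
  \<comment> \<open>A common vertex would have the same route from the root in both paths, so they
    would share their branch.\<close>
  have disj2: "set ps \<inter> set qs = {}"
  proof -
    have False if "i < l" "1 \<le> j" "j < l" "q0 ! i = q ! j" for i j
    proof -
      have *: "i = j" "take (Suc i) q0 = take (Suc i) q"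
        using paths_meet[OF q0P qP that(4)] that by auto
      then have "take (Suc i) q0 ! 1 = take (Suc i) q ! 1" by simp
      then show False using * that zs(7) by simp
    qed
    then show ?thesis by (force simp: set_ps set_qs)
  qed
  have dist: "distinct ps" "distinct qs"
    using nb_walk_distinct[OF noloop no_short, of "2 * l"] q0P qP l2
    by (auto simp: ps_def qs_def paths_def)
  have w: "walk E ps" "walk E qs"
    using q0P qP unfolding ps_def qs_def by (auto simp only: walk_rev paths_def nb_walk_def mem_Collect_eq intro: walk_take walk_drop)
  have edge: "{p ! i, p ! Suc i} \<in> E" if "p \<in> paths v (Suc l)" "i \<le> l" for p i
    using that successively_nth[of "\<lambda>x y. {x, y} \<in> E" p i] by (auto simp: paths_def nb_walk_def)
  have lens: "length ps = l" "length qs = l - 1"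
    using q0P qP by (auto simp: ps_def qs_def paths_def)
  have ends: "hd ps = v" "last ps = q0 ! (l - 1)" "hd qs = q ! (l - 1)" "last qs = q ! 1"
  proof -
    have len: "length q0 = Suc (Suc l)" "length q = Suc (Suc l)" "hd q0 = v"
      using q0P qP by (auto simp: paths_def)
    show "hd ps = v" using len l2 by (simp add: ps_def)
    have "take l q0 \<noteq> []" "drop 1 (take l q) \<noteq> []" using len l2 by auto
    then show "last ps = q0 ! (l - 1)" "hd qs = q ! (l - 1)" "last qs = q ! 1"
      using len l2 by (simp_all only: ps_def qs_def hd_rev last_rev last_drop)
       (simp_all add: last_conv_nth hd_drop_conv_nth Suc_diff_Suc numeral_2_eq_2)
  qed
  have ne: "ps \<noteq> []" "qs \<noteq> []" "zs \<noteq> []" using lens l2 zs(1) by auto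
  have "walk E (ps @ zs @ qs)"
    using w zs(3,4,6) ends ne edge[OF q0P, of "l - 1"] edge[OF qP, of "l - 1"] l2
    by (auto simp: successively_append_iff insert_commute)
  moreover have "q ! 0 = v" using qP by (cases q) (auto simp: paths_def)
  then have "{last (ps @ zs @ qs), hd (ps @ zs @ qs)} \<in> E"
    using ne ends edge[OF qP, of 0] by (simp add: insert_commute)
  moreover have "distinct (ps @ zs @ qs)" using disj disj2 dist zs(2) by auto
  moreover have "length (ps @ zs @ qs) = 2 * k" using lens zs(1) l2 kl by auto
  ultimately have "is_cycle E (2 * k) (ps @ zs @ qs)" using kl l2 by (auto simp: is_cycle_iff_walk)
  then show False using no_2k unfolding contains_cycle_def by blast
qed

section \<open>Rooted odd cycles and the two arcs from the root\<close>

definition cycles_from :: "nat \<Rightarrow> nat list set" where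
  "cycles_from v = {vs. is_cycle E (2 * l + 1) vs \<and> hd vs = v}"

text \<open>Only the first step is tested: for adjacent \<open>u\<close> and \<open>v\<close> this
  is exactly what allows \<open>u\<close> to be prepended without backtracking.\<close>

definition paths_avoiding :: "nat \<Rightarrow> nat \<Rightarrow> nat list set" where
  "paths_avoiding v u = {p \<in> paths v l. p ! 1 \<noteq> u}"

lemma finite_paths_avoiding: "finite (paths_avoiding v u)"
  by (simp add: paths_avoiding_def finite_paths)

lemma cycles_fromD:
  assumes "vs \<in> cycles_from v"
  shows "length vs = 2 * l + 1" "distinct vs" "walk E vs" "{v, last vs} \<in> E" "vs ! 0 = v" "vs \<noteq> []"
proof -
  show len: "length vs = 2 * l + 1" and "distinct vs" "walk E vs" "{v, last vs} \<in> E"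
    using assms by (auto simp: cycles_from_def is_cycle_iff_walk insert_commute)
  show "vs \<noteq> []" using len by auto
  then show "vs ! 0 = v" using assms by (simp add: cycles_from_def hd_conv_nth)
qed

lemma cycle_front_path: "vs \<in> cycles_from v \<Longrightarrow> j \<le> 2 * l \<Longrightarrow> take (Suc j) vs \<in> paths v j"
  using cycles_fromD[of vs v] by (auto simp: paths_def cycles_from_def intro!: nb_walk_if_distinct walk_take)

text \<open>This is the arc that leaves \<open>v\<close> through the last vertex and ends at
  position \<open>Suc l\<close>. Together with the first \<open>Suc l\<close> vertices and the edge
  between the two far ends it makes up the cycle.\<close>

lemma cycle_back_path:
  assumes "vs \<in> cycles_from v"
  shows "v # rev (drop (Suc l) vs) \<in> paths v l"
proof -
  note c = cycles_fromD[OF assms]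
  have ne: "drop (Suc l) vs \<noteq> []" using c(1) l2 by simp
  have "v \<notin> set (drop (Suc l) vs)"
    using c(2,5,6) by (cases vs) (auto dest: in_set_dropD)
  then have "distinct (v # rev (drop (Suc l) vs))" using c(2) by simp
  moreover have "walk E (v # rev (drop (Suc l) vs))"
    unfolding successively_Cons walk_rev using c(1,3,4) ne l2 by (auto simp: hd_rev intro: walk_drop)
  ultimately show ?thesis using c(1) by (auto simp: paths_def intro: nb_walk_if_distinct)
qed

text \<open>Two back arcs with the same ends have \<open>2 * l + 2\<close> vertices in total, so
  girth forces them to agree.\<close>

lemma cycle_back_unique:
  assumes "vs \<in> cycles_from v" "ws \<in> cycles_from v" "vs ! Suc l = ws ! Suc l"
  shows "drop (Suc l) vs = drop (Suc l) ws"
proof -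
  have *: "drop (Suc l) us \<noteq> [] \<and> last (v # rev (drop (Suc l) us)) = us ! Suc l" if "us \<in> cycles_from v" for us
    using cycles_fromD(1)[OF that] l2 by (simp add: last_rev hd_drop_conv_nth)
  have "v # rev (drop (Suc l) vs) = v # rev (drop (Suc l) ws)"
    by (rule walk_unique)
      (use cycle_back_path[OF assms(1)] cycle_back_path[OF assms(2)] *[OF assms(1)] *[OF assms(2)] assms(3)
        in \<open>auto simp: paths_def\<close>)
  then show ?thesis by simp
qed

text \<open>Given its edge \<open>vu\<close>, a cycle is determined by the opposite vertex, hence by the arc of length \<open>l\<close>
  from \<open>v\<close> that avoids \<open>u\<close>.\<close>

lemma card_cycles_from_through:
  "card {vs \<in> cycles_from v. vs ! 1 = u} \<le> card (paths_avoiding v u)"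
proof (rule card_inj_on_le[of "\<lambda>vs. v # rev (drop (Suc l) vs)"])
  show "inj_on (\<lambda>vs. v # rev (drop (Suc l) vs)) {vs \<in> cycles_from v. vs ! 1 = u}"
  proof (rule inj_onI)
    fix vs ws assume vs: "vs \<in> {vs \<in> cycles_from v. vs ! 1 = u}" and ws: "ws \<in> {vs \<in> cycles_from v. vs ! 1 = u}"
      and "v # rev (drop (Suc l) vs) = v # rev (drop (Suc l) ws)"
    then have eq: "drop (Suc l) vs = drop (Suc l) ws" by simp
    have vc: "vs \<in> cycles_from v" "vs ! 1 = u" and wc: "ws \<in> cycles_from v" "ws ! 1 = u" using vs ws by auto
    have nth: "vs ! Suc l = ws ! Suc l"
      using arg_cong[OF eq, of hd] cycles_fromD(1)[OF vc(1)] cycles_fromD(1)[OF wc(1)] l2 by (simp add: hd_drop_conv_nth)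
    \<comment> \<open>Dropping the root is essential: starting at \<open>u\<close>, each arc has
      \<open>l + 1\<close> vertices, which meets the bound for uniqueness exactly.\<close>
    have "tl (take (Suc (Suc l)) vs) = tl (take (Suc (Suc l)) ws)"
    proof (rule walk_unique)
      have len: "length vs = 2 * l + 1" "length ws = 2 * l + 1"
        using cycles_fromD(1) vc wc by auto
      have w: "take (Suc (Suc l)) vs \<in> paths v (Suc l)" "take (Suc (Suc l)) ws \<in> paths v (Suc l)"
        using cycle_front_path vc wc l2 by auto
      then show "nb_walk E (tl (take (Suc (Suc l)) vs))" "nb_walk E (tl (take (Suc (Suc l)) ws))"
        by (auto simp: paths_def intro: nb_walk_tl)
      show ne: "tl (take (Suc (Suc l)) vs) \<noteq> []" "tl (take (Suc (Suc l)) ws) \<noteq> []"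
        using len l2 by (auto simp flip: length_greater_0_conv)
      show "hd (tl (take (Suc (Suc l)) vs)) = hd (tl (take (Suc (Suc l)) ws))"
        using ne vc wc len l2 by (simp add: hd_conv_nth nth_tl)
      show "last (tl (take (Suc (Suc l)) vs)) = last (tl (take (Suc (Suc l)) ws))"
        using ne nth len l2 by (simp add: last_conv_nth nth_tl)
    qed (use l2 in auto)
    then have "take (Suc (Suc l)) vs = take (Suc (Suc l)) ws"
      using cycles_fromD(5,6)[OF vc(1)] cycles_fromD(5,6)[OF wc(1)] by (cases vs; cases ws) auto
    then have "take (Suc l) vs = take (Suc l) ws"
      by (metis le_SucI min.absorb1 order.refl take_take)
    then show "vs = ws" using eq by (metis append_take_drop_id)
  qed
  show "(\<lambda>vs. v # rev (drop (Suc l) vs)) ` {vs \<in> cycles_from v. vs ! 1 = u} \<subseteq> paths_avoiding v u"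
  proof
    fix p assume "p \<in> (\<lambda>vs. v # rev (drop (Suc l) vs)) ` {vs \<in> cycles_from v. vs ! 1 = u}"
    then obtain vs where vs: "vs \<in> cycles_from v" "vs ! 1 = u" "p = v # rev (drop (Suc l) vs)" by auto
    note c = cycles_fromD[OF vs(1)]
    have "p ! 1 = vs ! (2 * l)"
      using c(1) l2 by (simp add: vs(3) rev_nth mult_2)
    also have "\<dots> \<noteq> u" using c(1,2) vs(2) l2 by (auto simp: nth_eq_iff_index_eq)
    finally show "p \<in> paths_avoiding v u"
      using cycle_back_path[OF vs(1)] vs(3) by (simp add: paths_avoiding_def)
  qed
qed (rule finite_paths_avoiding)

lemma finite_cycles_from: "finite (cycles_from v)"
proof (rule finite_subset)
  show "cycles_from v \<subseteq> paths v (2 * l)"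
  proof
    fix vs assume "vs \<in> cycles_from v"
    then show "vs \<in> paths v (2 * l)" using cycle_front_path[of vs v "2 * l"] cycles_fromD(1)[of vs v] by simp
  qed
qed (rule finite_paths)

text \<open>Reversing the direction of travel swaps the second vertex with the last one.\<close>

lemma card_cycles_from_through_last:
  "card {vs \<in> cycles_from v. last vs = u} \<le> card {vs \<in> cycles_from v. vs ! 1 = u}"
proof (rule card_inj_on_le[of "\<lambda>vs. v # rev (tl vs)"])
  show "inj_on (\<lambda>vs. v # rev (tl vs)) {vs \<in> cycles_from v. last vs = u}"
  proof (rule inj_onI)
    fix vs ws assume "vs \<in> {vs \<in> cycles_from v. last vs = u}" "ws \<in> {vs \<in> cycles_from v. last vs = u}"
      "v # rev (tl vs) = v # rev (tl ws)"
    then show "vs = ws" using cycles_fromD(5,6)[of vs v] cycles_fromD(5,6)[of ws v] by (cases vs; cases ws) auto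
  qed
  show "(\<lambda>vs. v # rev (tl vs)) ` {vs \<in> cycles_from v. last vs = u} \<subseteq> {vs \<in> cycles_from v. vs ! 1 = u}"
  proof
    fix p assume "p \<in> (\<lambda>vs. v # rev (tl vs)) ` {vs \<in> cycles_from v. last vs = u}"
    then obtain vs where vs: "vs \<in> cycles_from v" "last vs = u" "p = v # rev (tl vs)" by auto
    note c = cycles_fromD[OF vs(1)]
    obtain ys where ys: "vs = v # ys" using c(5,6) by (cases vs) auto
    then have "ys \<noteq> []" using c(1) l2 by auto
    note ys = ys this
    have p: "p = v # rev ys" using vs(3) ys by simp
    have "walk E (v # ys)" using c(3) ys by simp
    then have "walk E ys" "{hd ys, v} \<in> E"
      using ys by (auto simp: successively_Cons insert_commute)
    moreover from this have "walk E (v # rev ys)"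
      unfolding successively_Cons walk_rev using c(4) ys by (auto simp: hd_rev)
    ultimately have "p \<in> cycles_from v" using c(1,2) ys l2 unfolding p cycles_from_def is_cycle_iff_walk by (simp add: last_rev)
    moreover have "p ! 1 = u" using ys vs(2) unfolding p by (simp add: hd_conv_nth[symmetric] hd_rev)
    ultimately show "p \<in> {vs \<in> cycles_from v. vs ! 1 = u}" by simp
  qed
qed (simp add: finite_cycles_from)

text \<open>Such a cycle is determined by its first \<open>l + 2\<close> vertices, because the back
  arc is fixed by its end. These prefixes are paths with \<open>l + 1\<close> edges, hence sparse,
  and both ends of their last edges are ends of arcs that do not start towards
  \<open>u\<close>.\<close>

lemma card_cycles_from_avoiding:
  "card {vs \<in> cycles_from v. vs ! 1 \<noteq> u \<and> last vs \<noteq> u} \<le> 4 * k * card (paths_avoiding v u)"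
proof -
  let ?C = "{vs \<in> cycles_from v. vs ! 1 \<noteq> u \<and> last vs \<noteq> u}"
  define Q where "Q = take (Suc (Suc l)) ` ?C"
  let ?A = "(\<lambda>p. p ! l) ` paths_avoiding v u"
  have nth: "vs ! Suc l = ws ! Suc l" if "take (Suc (Suc l)) vs = take (Suc (Suc l)) ws" for vs ws :: "nat list"
    using that by (metis lessI nth_take)
  have "inj_on (take (Suc (Suc l))) ?C"
  proof (rule inj_onI)
    fix vs ws assume vs: "vs \<in> ?C" and ws: "ws \<in> ?C" and eq: "take (Suc (Suc l)) vs = take (Suc (Suc l)) ws"
    have "drop (Suc l) vs = drop (Suc l) ws" using cycle_back_unique vs ws nth[OF eq] by blast
    moreover have "take (Suc l) vs = take (Suc l) ws"
      using eq by (metis le_SucI min.absorb1 order.refl take_take)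
    ultimately show "vs = ws" by (metis append_take_drop_id)
  qed
  then have "card ?C = card Q" unfolding Q_def by (simp add: card_image)
  also have "\<dots> \<le> 2 * k * (card ((\<lambda>p. p ! l) ` Q) + card ((\<lambda>p. p ! Suc l) ` Q))"
    using cycle_front_path l2 by (intro last_step_sparse[of _ v]) (auto simp: Q_def)
  also have "\<dots> \<le> 2 * k * (card ?A + card ?A)"
  proof (intro mult_left_mono add_mono card_mono)
    show "(\<lambda>p. p ! l) ` Q \<subseteq> ?A"
    proof
      fix x assume "x \<in> (\<lambda>p. p ! l) ` Q"
      then obtain vs where vs: "vs \<in> ?C" "x = vs ! l" by (auto simp: Q_def)
      have "take (Suc l) vs \<in> paths_avoiding v u"
        using vs(1) cycle_front_path[of vs v l] l2 by (auto simp: paths_avoiding_def)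
      then show "x \<in> ?A" using vs(2) by (intro image_eqI[of _ _ "take (Suc l) vs"]) auto
    qed
    \<comment> \<open>Here the witness is the back arc, whose first step goes to the last vertex of
      the cycle.\<close>
    show "(\<lambda>p. p ! Suc l) ` Q \<subseteq> ?A"
    proof
      fix x assume "x \<in> (\<lambda>p. p ! Suc l) ` Q"
      then obtain vs where vs: "vs \<in> ?C" "x = vs ! Suc l" by (auto simp: Q_def)
      note c = cycles_fromD[of vs v]
      have len: "length vs = 2 * l + 1" using vs(1) c by auto
      have "(v # rev (drop (Suc l) vs)) ! 1 = last vs" "(v # rev (drop (Suc l) vs)) ! l = x"
        using len l2 vs(2) by (auto simp: rev_nth last_conv_nth nth_Cons' mult_2 simp flip: length_greater_0_conv)
      moreover have "v # rev (drop (Suc l) vs) \<in> paths v l" using vs(1) cycle_back_path by auto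
      ultimately show "x \<in> ?A" using vs(1)
        by (intro image_eqI[of _ _ "v # rev (drop (Suc l) vs)"]) (auto simp: paths_avoiding_def)
    qed
  qed (auto simp: finite_paths_avoiding)
  also have "\<dots> \<le> 2 * k * (card (paths_avoiding v u) + card (paths_avoiding v u))"
    by (intro mult_left_mono add_mono card_image_le finite_paths_avoiding) auto
  finally show ?thesis by (simp add: algebra_simps)
qed

text \<open>The vertex \<open>u\<close> is second, last, or neither; the three cases contribute 1, 1
  and \<open>4 * k\<close>. The freedom in choosing \<open>u\<close> is used when \<open>u\<close>
  becomes a vertex of maximal degree.\<close>

lemma card_cycles_from_le: "card (cycles_from v) \<le> (4 * k + 2) * card (paths_avoiding v u)"
proof -
  have "cycles_from v = {vs \<in> cycles_from v. vs ! 1 = u} \<union> {vs \<in> cycles_from v. last vs = u}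
      \<union> {vs \<in> cycles_from v. vs ! 1 \<noteq> u \<and> last vs \<noteq> u}" by auto
  then have "card (cycles_from v) \<le> card {vs \<in> cycles_from v. vs ! 1 = u} + card {vs \<in> cycles_from v. last vs = u}
      + card {vs \<in> cycles_from v. vs ! 1 \<noteq> u \<and> last vs \<noteq> u}"
    by (metis (no_types, lifting) card_Un_le add_le_mono1 order_trans)
  also have "\<dots> \<le> (4 * k + 2) * card (paths_avoiding v u)"
    using card_cycles_from_through[of v u] card_cycles_from_through_last[of v u] card_cycles_from_avoiding[of v u]
    by simp
  finally show ?thesis .
qed

section \<open>Path counts and the maximal degree\<close>

lemma card_paths_Suc_l: "card (paths v (Suc l)) \<le> 4 * k * n"
proof -
  have "card (paths v (Suc l)) \<le>
     2 * k * (card ((\<lambda>p. p ! l) ` paths v (Suc l)) + card ((\<lambda>p. p ! Suc l) ` paths v (Suc l)))"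
    by (rule last_step_sparse[OF order.refl])
  also have "\<dots> \<le> 2 * k * (card {..<n} + card {..<n})"
    using l2 by (intro mult_left_mono add_mono card_mono) (auto intro: nth_paths_less)
  finally show ?thesis by (simp add: algebra_simps)
qed

text \<open>Prepending \<open>v\<close> is injective and creates no backtracking, since the paths
  from \<open>u\<close> do not start towards \<open>v\<close>.\<close>

lemma sum_card_paths_avoiding: "(\<Sum>u\<in>nbrs v. card (paths_avoiding u v)) \<le> card (paths v (Suc l))"
proof -
  have "(\<Sum>u\<in>nbrs v. card (paths_avoiding u v)) = card (SIGMA u:nbrs v. paths_avoiding u v)"
    by (simp add: card_SigmaI finite_nbrs finite_paths_avoiding)
  also have "\<dots> \<le> card (paths v (Suc l))"
  proof (rule card_inj_on_le[of "\<lambda>(u, p). v # p"])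
    show "inj_on (\<lambda>(u, p). v # p) (SIGMA u:nbrs v. paths_avoiding u v)"
      by (auto simp: inj_on_def paths_avoiding_def paths_def)
    show "(\<lambda>(u, p). v # p) ` (SIGMA u:nbrs v. paths_avoiding u v) \<subseteq> paths v (Suc l)"
      by (auto simp: paths_avoiding_def paths_def nbrs_def nb_walk_Cons insert_commute)
  qed (rule finite_paths)
  finally show ?thesis .
qed

lemma card_paths_le:
  assumes "\<And>u. card (nbrs u) \<le> \<Delta>"
  shows "card (paths v j) \<le> \<Delta> ^ j"
proof (induction j arbitrary: v)
  case 0
  have "paths v 0 \<subseteq> {[v]}" by (auto simp: paths_def length_Suc_conv)
  then have "card (paths v 0) \<le> card {[v]}" by (intro card_mono) auto
  then show ?case by simp
next
  case (Suc j)
  have "card (paths v (Suc j)) \<le> card (SIGMA u:nbrs v. paths u j)"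
  proof (rule card_inj_on_le[of "\<lambda>p. (hd (tl p), tl p)"])
    show "inj_on (\<lambda>p. (hd (tl p), tl p)) (paths v (Suc j))"
    proof (rule inj_onI)
      fix p q assume pq: "p \<in> paths v (Suc j)" "q \<in> paths v (Suc j)" and eq: "(hd (tl p), tl p) = (hd (tl q), tl q)"
      have "p = v # tl p" "q = v # tl q" using pq by (cases p; cases q; simp add: paths_def)+
      then show "p = q" using eq by (metis snd_conv)
    qed
    show "(\<lambda>p. (hd (tl p), tl p)) ` paths v (Suc j) \<subseteq> (SIGMA u:nbrs v. paths u j)"
    proof
      fix x assume "x \<in> (\<lambda>p. (hd (tl p), tl p)) ` paths v (Suc j)"
      then obtain p where p: "p \<in> paths v (Suc j)" and x: "x = (hd (tl p), tl p)" by auto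
      obtain q where q: "p = v # q" using p by (cases p) (auto simp: paths_def)
      then have "q \<noteq> []" using p by (auto simp: paths_def)
      with q show "x \<in> (SIGMA u:nbrs v. paths u j)"
        using p by (auto simp: x paths_def nbrs_def nb_walk_Cons insert_commute)
    qed
  qed (auto simp: finite_nbrs finite_paths)
  also have "\<dots> = (\<Sum>u\<in>nbrs v. card (paths u j))"
    by (simp add: card_SigmaI finite_nbrs finite_paths)
  also have "\<dots> \<le> (\<Sum>u\<in>nbrs v. \<Delta> ^ j)" by (intro sum_mono Suc.IH)
  also have "\<dots> \<le> \<Delta> * \<Delta> ^ j" using assms[of v] by simp
  finally show ?case by simp
qed

text \<open>Write \<open>c = 4k + 2\<close>; the hypothesis says that \<open>M\<close> is at least
  \<open>c^2\<close> times \<open>n\<close> to the power \<open>l / (l + 1)\<close>. If every vertex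
  had more than \<open>M\<close> rooted cycles, maximal degree \<open>\<Delta>\<close> would give
  both \<open>\<Delta> * M \<le> c^2 * n\<close> and \<open>M < c * \<Delta>^l\<close>. Eliminating
  \<open>\<Delta>\<close> contradicts the hypothesis.\<close>

lemma exists_vertex_few_cycles:
  assumes "E \<noteq> {}" and M: "((4 * real k + 2)\<^sup>2) ^ Suc l * real n ^ l \<le> M ^ Suc l" "M > 0"
  shows "\<exists>v\<in>\<Union>E. real (card (cycles_from v)) \<le> M"
proof (rule ccontr)
  assume "\<not> ?thesis"
  then have big: "real (card (cycles_from v)) > M" if "v \<in> \<Union>E" for v using that by (auto simp: not_le)
  define c where "c = 4 * real k + 2"
  have c: "c \<ge> 1" by (simp add: c_def)
  have fin: "finite (\<Union>E)"
    by (rule finite_subset[of _ "{..<n}"]) (use simple in \<open>auto simp: simple_graph_def\<close>)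
  have ne: "\<Union>E \<noteq> {}"
  proof -
    obtain e where "e \<in> E" using assms(1) by blast
    moreover from this obtain x y where "e = {x, y}" using simple by (auto simp: simple_graph_def)
    ultimately show ?thesis by blast
  qed
  obtain v where v: "v \<in> \<Union>E" and vMax: "card (nbrs v) = Max ((\<lambda>v. card (nbrs v)) ` \<Union>E)"
    using Max_in[of "(\<lambda>v. card (nbrs v)) ` \<Union>E"] fin ne by fastforce
  have vmax: "card (nbrs u) \<le> card (nbrs v)" if "u \<in> \<Union>E" for u
    unfolding vMax using fin that by (intro Max_ge) auto
  define \<Delta> where "\<Delta> = card (nbrs v)"
  have \<Delta>: "card (nbrs u) \<le> \<Delta>" for u
  proof (cases "u \<in> \<Union>E")
    case False
    then have "nbrs u = {}" by (auto simp: nbrs_def)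
    then show ?thesis by simp
  qed (simp add: vmax \<Delta>_def)
  have cyc_le: "real (card (cycles_from u)) \<le> c * real (card (paths_avoiding u w))" for u w
  proof -
    have "real (card (cycles_from u)) \<le> real ((4 * k + 2) * card (paths_avoiding u w))"
      using card_cycles_from_le of_nat_le_iff by blast
    then show ?thesis by (simp add: c_def algebra_simps)
  qed
  have "real \<Delta> * M = (\<Sum>u\<in>nbrs v. M)" by (simp add: \<Delta>_def)
  also have "\<dots> \<le> (\<Sum>u\<in>nbrs v. c * real (card (paths_avoiding u v)))"
  proof (rule sum_mono)
    fix u assume "u \<in> nbrs v"
    then have "u \<in> \<Union>E" by (auto simp: nbrs_def)
    then show "M \<le> c * real (card (paths_avoiding u v))" using big[of u] cyc_le[of u v] by simp
  qed
  also have "\<dots> = c * real (\<Sum>u\<in>nbrs v. card (paths_avoiding u v))" by (simp add: sum_distrib_left)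
  also have "\<dots> \<le> c * real (4 * k * n)"
    using sum_card_paths_avoiding[of v] card_paths_Suc_l[of v] c
    by (intro mult_left_mono) (auto simp only: of_nat_le_iff)
  also have "\<dots> \<le> c * (c * real n)"
    using c by (intro mult_left_mono) (auto simp: c_def algebra_simps)
  finally have DM: "real \<Delta> * M \<le> c\<^sup>2 * real n" by (simp add: power2_eq_square)
  have "M < real (card (cycles_from v))" using big v by simp
  \<comment> \<open>Any avoided vertex would do here, since only the bound by all paths with
    \<open>l\<close> edges is used.\<close>
  also have "\<dots> \<le> c * real (card (paths_avoiding v v))" by (rule cyc_le)
  also have "\<dots> \<le> c * real (\<Delta> ^ l)"
  proof -
    have "card (paths_avoiding v v) \<le> card (paths v l)"
      by (intro card_mono finite_paths) (auto simp: paths_avoiding_def)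
    also have "\<dots> \<le> \<Delta> ^ l" by (rule card_paths_le[OF \<Delta>])
    finally show ?thesis using c by (intro mult_left_mono) (auto simp only: of_nat_le_iff)
  qed
  finally have M1: "M < c * real \<Delta> ^ l" by simp
  \<comment> \<open>Multiplying by \<open>M ^ l\<close> pairs each factor \<open>\<Delta>\<close>
    with one factor \<open>M\<close>, so that \<open>DM\<close> applies \<open>l\<close>
    times.\<close>
  then have "M ^ Suc l < (c * real \<Delta> ^ l) * M ^ l" using M(2) by simp
  also have "\<dots> = c * (real \<Delta> * M) ^ l" by (simp add: power_mult_distrib)
  also have "\<dots> \<le> c\<^sup>2 * (c\<^sup>2 * real n) ^ l"
  proof (rule mult_mono)
    show "c \<le> c\<^sup>2" using c by (simp add: power2_eq_square)
    show "(real \<Delta> * M) ^ l \<le> (c\<^sup>2 * real n) ^ l" using DM M(2) by (intro power_mono) auto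
  qed (use M(2) in auto)
  also have "\<dots> = (c\<^sup>2) ^ Suc l * real n ^ l" by (simp add: power_mult_distrib)
  finally show False using M(1) unfolding c_def by simp
qed

end

section \<open>The upper bound\<close>

lemma is_cycle_rotate1:
  assumes "is_cycle E m vs" shows "is_cycle E m (rotate1 vs)"
proof (cases vs)
  case (Cons x xs)
  then have "xs \<noteq> []" using assms by (auto simp: is_cycle_def)
  moreover have "walk E (x # xs)" using assms Cons by (simp add: is_cycle_iff_walk)
  then have "walk E xs" "{x, hd xs} \<in> E" using \<open>xs \<noteq> []\<close> by (auto simp: successively_Cons)
  ultimately show ?thesis
    using assms Cons by (auto simp: is_cycle_iff_walk successively_append_iff)
qed (use assms in \<open>auto simp: is_cycle_def\<close>)

lemma is_cycle_rotate: "is_cycle E m vs \<Longrightarrow> is_cycle E m (rotate i vs)"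
  by (induction i) (auto simp: is_cycle_rotate1)

lemma rotate_inj: "rotate i xs = rotate i ys \<Longrightarrow> xs = ys"
  by (induction i) (auto simp: inj_eq[OF inj_rotate1])

lemma simple_graph_cycle_vertices:
  assumes "simple_graph n E" "is_cycle E m vs"
  shows "set vs \<subseteq> {..<n}"
proof
  fix x assume "x \<in> set vs"
  then obtain i where i: "i < m" "x = vs ! i" using assms(2) by (auto simp: in_set_conv_nth is_cycle_def)
  then have "{x, vs ! ((i + 1) mod m)} \<in> E" using assms(2) by (auto simp: is_cycle_def)
  then show "x \<in> {..<n}" using assms(1) by (auto simp: simple_graph_def doubleton_eq_iff)
qed

lemma finite_cycles:
  assumes "simple_graph n E"
  shows "finite {vs. is_cycle E m vs}"
proof (rule finite_subset)
  show "{vs. is_cycle E m vs} \<subseteq> {vs. set vs \<subseteq> {..<n} \<and> length vs = m}"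
    using simple_graph_cycle_vertices[OF assms] by (auto simp: is_cycle_def)
qed (simp add: finite_lists_length_eq)

text \<open>For each possible position of \<open>v\<close>, rotating \<open>v\<close> to the front
  is injective.\<close>

lemma card_cycles_through_vertex:
  assumes "simple_graph n E"
  shows "card {vs. is_cycle E m vs \<and> v \<in> set vs} \<le> m * card {vs. is_cycle E m vs \<and> hd vs = v}"
proof -
  have fin: "finite {vs. is_cycle E m vs \<and> P vs}" for P
    using finite_cycles[OF assms] by simp
  have "{vs. is_cycle E m vs \<and> v \<in> set vs} \<subseteq> (\<Union>i<m. {vs. is_cycle E m vs \<and> vs ! i = v})"
    by (auto simp: is_cycle_def in_set_conv_nth)
  then have "card {vs. is_cycle E m vs \<and> v \<in> set vs} \<le> card (\<Union>i<m. {vs. is_cycle E m vs \<and> vs ! i = v})"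
    using fin by (intro card_mono) auto
  also have "\<dots> \<le> (\<Sum>i<m. card {vs. is_cycle E m vs \<and> vs ! i = v})"
    by (rule card_UN_le) simp
  also have "\<dots> \<le> (\<Sum>i<m. card {vs. is_cycle E m vs \<and> hd vs = v})"
  proof (rule sum_mono)
    fix i assume "i \<in> {..<m}"
    then have "hd (rotate i vs) = vs ! i" if "is_cycle E m vs" for vs
      using that by (subst hd_rotate_conv_nth) (auto simp: is_cycle_def)
    then show "card {vs. is_cycle E m vs \<and> vs ! i = v} \<le> card {vs. is_cycle E m vs \<and> hd vs = v}"
      by (intro card_inj_on_le[of "rotate i"] inj_onI fin)
        (auto simp: is_cycle_rotate dest: rotate_inj)
  qed
  finally show ?thesis by simp
qed

lemma contains_cycle_mono: "contains_cycle E j \<Longrightarrow> E \<subseteq> E' \<Longrightarrow> contains_cycle E' j"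
  unfolding contains_cycle_def is_cycle_def by blast

lemma girth_graph_subset:
  assumes "girth_graph E n k l" "E' \<subseteq> E"
  shows "girth_graph E' n k l"
proof -
  interpret girth_graph E n k l by fact
  show ?thesis
    using simple l2 kl no_short no_2k assms(2) contains_cycle_mono[OF _ assms(2)]
    by unfold_locales (auto simp: simple_graph_def)
qed

text \<open>Repeatedly delete the edges at a vertex with few rooted cycles; each round destroys at
  most \<open>(2 * l + 1) * M\<close> traversals. The number \<open>n\<close> stays fixed, so one
  \<open>M\<close> serves all rounds, and the induction runs over the non-isolated vertices.\<close>

lemma card_cycles_le:
  assumes "girth_graph E n k l"
    and M: "((4 * real k + 2)\<^sup>2) ^ Suc l * real n ^ l \<le> M ^ Suc l" "M > 0"
  shows "real (card {vs. is_cycle E (2 * l + 1) vs}) \<le> real (card (\<Union>E)) * (real (2 * l + 1) * M)"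
  using assms(1)
proof (induction "card (\<Union>E)" arbitrary: E rule: less_induct)
  case less
  interpret girth_graph E n k l by fact
  let ?m = "2 * l + 1"
  show ?case
  proof (cases "E = {}")
    case True
    then have "{vs. is_cycle E ?m vs} = {}" using l2 by (auto simp: is_cycle_def)
    then show ?thesis using M(2) by (simp only: card.empty) simp
  next
    case False
    from exists_vertex_few_cycles[OF False M] obtain v where v: "v \<in> \<Union>E" "real (card (cycles_from v)) \<le> M"
      by blast
    define E' where "E' = {e \<in> E. v \<notin> e}"
    have fin: "finite (\<Union>E)"
      by (rule finite_subset[of _ "{..<n}"]) (use simple in \<open>auto simp: simple_graph_def\<close>)
    have sub: "\<Union>E' \<subseteq> \<Union>E - {v}" by (auto simp: E'_def)
    have "card (\<Union>E') \<le> card (\<Union>E - {v})" using fin sub by (intro card_mono) auto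
    then have card_lt: "card (\<Union>E') + 1 \<le> card (\<Union>E)" using v(1) fin card_Suc_Diff1[of "\<Union>E" v] by simp
    have "girth_graph E' n k l" using less.prems by (rule girth_graph_subset) (auto simp: E'_def)
    then have IH: "real (card {vs. is_cycle E' ?m vs}) \<le> real (card (\<Union>E')) * (real ?m * M)"
      using card_lt by (intro less.hyps) auto
    have "{vs. is_cycle E ?m vs} \<subseteq> {vs. is_cycle E' ?m vs} \<union> {vs. is_cycle E ?m vs \<and> v \<in> set vs}"
    proof
      fix vs assume "vs \<in> {vs. is_cycle E ?m vs}"
      then have vs: "is_cycle E ?m vs" by simp
      have "is_cycle E' ?m vs" if "v \<notin> set vs"
        using vs that unfolding is_cycle_def E'_def by auto
      then show "vs \<in> {vs. is_cycle E' ?m vs} \<union> {vs. is_cycle E ?m vs \<and> v \<in> set vs}" using vs by auto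
    qed
    moreover have "finite ({vs. is_cycle E' ?m vs} \<union> {vs. is_cycle E ?m vs \<and> v \<in> set vs})"
      using finite_cycles[OF simple, of ?m] finite_cycles[OF girth_graph.simple[OF \<open>girth_graph E' n k l\<close>], of ?m]
      by simp
    ultimately have "card {vs. is_cycle E ?m vs} \<le> card {vs. is_cycle E' ?m vs} + card {vs. is_cycle E ?m vs \<and> v \<in> set vs}"
      by (meson card_Un_le card_mono order_trans)
    also have "\<dots> \<le> card {vs. is_cycle E' ?m vs} + ?m * card (cycles_from v)"
      using card_cycles_through_vertex[OF simple, of ?m v] by (simp add: cycles_from_def)
    finally have "real (card {vs. is_cycle E ?m vs}) \<le> real (card {vs. is_cycle E' ?m vs} + ?m * card (cycles_from v))"
      by (simp only: of_nat_le_iff)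
    also have "\<dots> \<le> real (card (\<Union>E')) * (real ?m * M) + real ?m * M"
      using IH v(2) unfolding of_nat_add of_nat_mult by (intro add_mono mult_left_mono) auto
    also have "\<dots> = real (card (\<Union>E') + 1) * (real ?m * M)" by (simp add: algebra_simps)
    also have "\<dots> \<le> real (card (\<Union>E)) * (real ?m * M)"
      using card_lt M(2) by (intro mult_right_mono) (auto simp only: of_nat_le_iff, simp)
    finally show ?thesis .
  qed
qed

lemma count_cycles_upper:
  assumes "girth_graph E n k l" "n > 0"
  shows "real (count_cycles E (2 * l + 1))
    \<le> real (2 * l + 1) * (4 * real k + 2)\<^sup>2 * real n powr (1 + real l / (real l + 1))"
proof -
  interpret girth_graph E n k l by fact
  \<comment> \<open>This is the least value permitted: the hypothesis on \<open>M\<close> holds with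
    equality.\<close>
  define M where "M = (4 * real k + 2)\<^sup>2 * real n powr (real l / (real l + 1))"
  have M0: "M > 0" using assms(2) by (simp add: M_def)
  have "(real n powr (real l / (real l + 1))) ^ Suc l = real n powr real l"
    using assms(2) by (subst powr_realpow[symmetric], simp, subst powr_powr) (simp add: add.commute)
  then have "((4 * real k + 2)\<^sup>2) ^ Suc l * real n ^ l \<le> M ^ Suc l"
    using assms(2) by (simp only: M_def power_mult_distrib) (simp add: powr_realpow)
  note bound = card_cycles_le[OF assms(1) this M0]
  have "{cycle_edges (2 * l + 1) vs | vs. is_cycle E (2 * l + 1) vs}
      = cycle_edges (2 * l + 1) ` {vs. is_cycle E (2 * l + 1) vs}" by auto
  then have "count_cycles E (2 * l + 1) \<le> card {vs. is_cycle E (2 * l + 1) vs}"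
    using finite_cycles[OF simple] by (simp add: count_cycles_def card_image_le)
  then have "real (count_cycles E (2 * l + 1)) \<le> real (card (\<Union>E)) * (real (2 * l + 1) * M)"
    using bound by linarith
  also have "\<dots> \<le> real n * (real (2 * l + 1) * M)"
  proof -
    have "card (\<Union>E) \<le> card {..<n}"
      by (rule card_mono) (use simple in \<open>auto simp: simple_graph_def\<close>)
    then show ?thesis using M0 by (intro mult_right_mono) auto
  qed
  also have "\<dots> = real (2 * l + 1) * (4 * real k + 2)\<^sup>2 * real n powr (1 + real l / (real l + 1))"
    using assms(2) by (simp add: M_def powr_add)
  finally show ?thesis .
qed

section \<open>Adding a cycle through distant vertices\<close>

text \<open>Including \<open>Id\<close> makes the powers of \<open>near E\<close> the relations ``distance at most \<open>i\<close>''.\<close>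

definition near :: "nat set set \<Rightarrow> (nat \<times> nat) set" where
  "near E = {(x, y). {x, y} \<in> E} \<union> Id"

definition degree :: "nat set set \<Rightarrow> nat \<Rightarrow> nat" where
  "degree E v = card {u. {u, v} \<in> E}"

lemma sym_relpow: "sym R \<Longrightarrow> sym (R ^^ i)"
proof (induction i)
  case (Suc i)
  have "(R ^^ Suc i)\<inverse> = R ^^ Suc i"
    using Suc by (simp add: converse_relcomp sym_conv_converse_eq relpow_commute)
  then show ?case by (simp add: sym_conv_converse_eq)
qed (simp add: sym_Id)

lemma sym_near: "sym (near E)"
  by (auto simp: near_def sym_def insert_commute)

lemma near_relpow_mono: "(x, y) \<in> near E ^^ i \<Longrightarrow> i \<le> j \<Longrightarrow> (x, y) \<in> near E ^^ j"
proof (induction j)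
  case (Suc j)
  show ?case
  proof (cases "i = Suc j")
    case False
    then have "(x, y) \<in> near E ^^ j" using Suc by auto
    then show ?thesis by (auto simp: near_def)
  qed (use Suc in simp)
qed auto

lemma near_relpow_walk:
  "(\<And>t. t < d \<Longrightarrow> {w (a + t), w (Suc (a + t))} \<in> E) \<Longrightarrow> (w a, w (a + d)) \<in> near E ^^ d"
proof (induction d)
  case (Suc d)
  then have "(w a, w (a + d)) \<in> near E ^^ d" "(w (a + d), w (a + Suc d)) \<in> near E"
    by (auto simp: near_def)
  then show ?case by auto
qed simp

lemma card_near_ball:
  assumes "\<And>v. finite {u. {u, v} \<in> E}" "\<And>v. degree E v \<le> D"
  shows "finite ((near E ^^ i) `` {u}) \<and> card ((near E ^^ i) `` {u}) \<le> (D + 1) ^ i"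
proof (induction i)
  case (Suc i)
  let ?B = "(near E ^^ i) `` {u}"
  have near1: "near E `` {x} = insert x {y. {y, x} \<in> E}" for x
    by (auto simp: near_def insert_commute)
  have eq: "(near E ^^ Suc i) `` {u} = (\<Union>x\<in>?B. near E `` {x})" by auto
  have "card ((near E ^^ Suc i) `` {u}) \<le> (\<Sum>x\<in>?B. card (near E `` {x}))"
    unfolding eq using Suc by (intro card_UN_le) auto
  also have "\<dots> \<le> (\<Sum>x\<in>?B. D + 1)"
  proof (rule sum_mono)
    fix x
    show "card (near E `` {x}) \<le> D + 1"
      using assms(2)[of x] unfolding near1 degree_def by (simp add: card_insert_if assms(1))
  qed
  also have "\<dots> = card ?B * (D + 1)" by simp
  also have "\<dots> \<le> (D + 1) ^ i * (D + 1)" using Suc by (intro mult_right_mono) auto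
  finally have "card ((near E ^^ Suc i) `` {u}) \<le> (D + 1) ^ Suc i" by (simp add: mult.commute)
  moreover have "finite ((near E ^^ Suc i) `` {u})" unfolding eq using Suc assms(1) by (simp add: near1)
  ultimately show ?case by blast
qed simp

text \<open>The index \<open>(a + r - 1) mod r\<close> is the predecessor of \<open>a\<close>;
  adding \<open>r\<close> first keeps natural subtraction from truncating at
  \<open>a = 0\<close>.\<close>

lemma cycle_edges_nbrs:
  assumes "distinct xs" "length xs = r" "a < r" "{u, xs ! a} \<in> cycle_edges r xs"
  shows "u \<in> {xs ! ((a + 1) mod r), xs ! ((a + r - 1) mod r)}"
proof -
  obtain i where i: "i < r" "{u, xs ! a} = {xs ! i, xs ! ((i + 1) mod r)}"
    using assms(4) by (auto simp: cycle_edges_def)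
  have m: "(i + 1) mod r < r" using i(1) by auto
  from i(2) consider "u = xs ! ((i + 1) mod r)" "xs ! a = xs ! i" | "u = xs ! i" "xs ! a = xs ! ((i + 1) mod r)"
    by (auto simp: doubleton_eq_iff)
  then show ?thesis
  proof cases
    case 1
    then have "a = i" using assms i by (simp add: nth_eq_iff_index_eq)
    then show ?thesis using 1 by simp
  next
    case 2
    then have a: "a = (i + 1) mod r" using assms m by (simp add: nth_eq_iff_index_eq)
    have "(a + r - 1) mod r = i"
    proof (cases "i + 1 = r")
      case True
      then show ?thesis using a i(1) by auto
    next
      case False
      then have "a = i + 1" using a i(1) by simp
      then show ?thesis using i(1) by simp
    qed
    then show ?thesis using 2 by simp
  qed
qed

lemma cycle_edges_subset: "length xs = r \<Longrightarrow> e \<in> cycle_edges r xs \<Longrightarrow> e \<subseteq> set xs"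
  by (auto simp: cycle_edges_def intro!: nth_mem mod_less_divisor)

lemma rotate_to_vertex:
  assumes "is_cycle E j vs" "x \<in> set vs"
  obtains ws where "is_cycle E j ws" "hd ws = x" "set ws = set vs"
proof -
  obtain i where i: "i < length vs" "vs ! i = x" using assms(2) by (auto simp: in_set_conv_nth)
  then have "hd (rotate i vs) = x" by (subst hd_rotate_conv_nth) auto
  then show thesis using that[of "rotate i vs"] is_cycle_rotate[OF assms(1)] by simp
qed

text \<open>A vertex of the inner cycle has two different neighbours there, while the outer cycle
  offers only its predecessor and successor. So the inner vertex set is closed under successors and
  exhausts the outer one.\<close>

lemma cycle_in_cycle:
  assumes xs: "distinct xs" "length xs = r" "r \<ge> 3" and vs: "is_cycle (cycle_edges r xs) j vs"
  shows "j = r"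
proof -
  have sub: "set vs \<subseteq> set xs"
  proof
    fix x assume "x \<in> set vs"
    then obtain i where "i < j" "x = vs ! i" using vs by (auto simp: in_set_conv_nth is_cycle_def)
    then have "{x, vs ! ((i + 1) mod j)} \<in> cycle_edges r xs" using vs by (auto simp: is_cycle_def)
    then show "x \<in> set xs" using cycle_edges_subset[OF xs(2)] by blast
  qed
  have succ: "xs ! ((a + 1) mod r) \<in> set vs" if a: "a < r" "xs ! a \<in> set vs" for a
  proof -
    obtain ws where ws: "is_cycle (cycle_edges r xs) j ws" "hd ws = xs ! a" "set ws = set vs"
      using rotate_to_vertex[OF vs a(2)] .
    then obtain y z zs where ws': "ws = xs ! a # y # z # zs"
      by (cases ws; cases "tl ws"; cases "tl (tl ws)") (auto simp: is_cycle_def)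
    have "{last ws, xs ! a} \<in> cycle_edges r xs" "{y, xs ! a} \<in> cycle_edges r xs" "last ws \<noteq> y"
      using ws(1) unfolding is_cycle_iff_walk ws' by (auto simp: insert_commute split: if_splits)
    then have "xs ! ((a + 1) mod r) = last ws \<or> xs ! ((a + 1) mod r) = y"
      using cycle_edges_nbrs[OF xs(1,2) a(1), of "last ws"] cycle_edges_nbrs[OF xs(1,2) a(1), of y] by auto
    moreover have "last ws \<in> set ws" "y \<in> set ws" by (simp_all add: ws')
    ultimately show ?thesis unfolding ws(3) by metis
  qed
  have vs0: "vs ! 0 \<in> set vs" using vs by (intro nth_mem) (auto simp: is_cycle_def)
  then have "vs ! 0 \<in> set xs" using sub by blast
  then obtain a where a: "a < r" "xs ! a = vs ! 0" using xs(2) by (auto simp: in_set_conv_nth)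
  have all: "xs ! ((a + t) mod r) \<in> set vs" for t
  proof (induction t)
    case 0
    then show ?case using a vs0 by simp
  next
    case (Suc t)
    have "((a + t) mod r + 1) mod r = (a + Suc t) mod r" by (simp add: mod_Suc_eq)
    then show ?case using succ[of "(a + t) mod r"] Suc a(1) by simp
  qed
  have "set xs \<subseteq> set vs"
  proof
    fix x assume "x \<in> set xs"
    then obtain b where b: "b < r" "x = xs ! b" using xs(2) by (auto simp: in_set_conv_nth)
    have "(a + (b + r - a)) mod r = b" using a(1) b(1) by simp
    then show "x \<in> set vs" using all[of "b + r - a"] b(2) by simp
  qed
  then have "set xs = set vs" using sub by blast
  then show ?thesis using xs vs distinct_card[of xs] distinct_card[of vs] by (simp add: is_cycle_def)
qed

text \<open>A cycle using a new edge either consists of new edges only, which forces length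
  \<open>r\<close>, or contains old edges between two new ones. Such an old stretch would join two
  different vertices of \<open>xs\<close> within distance \<open>g\<close>.\<close>

lemma cycle_after_adding_far_cycle:
  assumes xs: "distinct xs" "length xs = r" "r \<ge> 3"
    and far: "\<And>x y. x \<in> set xs \<Longrightarrow> y \<in> set xs \<Longrightarrow> x \<noteq> y \<Longrightarrow> (x, y) \<notin> near E ^^ g"
    and vs: "is_cycle (E \<union> cycle_edges r xs) j vs" and "j \<le> g"
  shows "is_cycle E j vs \<or> j = r"
proof (rule ccontr)
  assume neg: "\<not> ?thesis"
  let ?C = "cycle_edges r xs"
  obtain i where i: "i < j" "{vs ! i, vs ! ((i + 1) mod j)} \<notin> E"
    using neg vs by (auto simp: is_cycle_def)
  \<comment> \<open>The rotation makes a non-old edge the closing one, so that no run of old edges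
    wraps around the end of the list.\<close>
  define ws where "ws = rotate (Suc i) vs"
  have ws: "is_cycle (E \<union> ?C) j ws" unfolding ws_def by (rule is_cycle_rotate[OF vs])
  have len: "length ws = j" and dist: "distinct ws" and j3: "3 \<le> j" using ws by (auto simp: is_cycle_def)
  define w where "w t = ws ! (t mod j)" for t
  have w_edge: "{w t, w (Suc t)} \<in> E \<union> ?C" if "t < j" for t
    using ws that by (auto simp: is_cycle_def w_def)
  have w_last: "{w (j - 1), w (Suc (j - 1))} \<notin> E"
  proof -
    have j: "length vs = j" using vs by (simp add: is_cycle_def)
    have "Suc i + (j - 1) = i + j" using j3 by simp
    then have "w (j - 1) = vs ! i"
      using i(1) j j3 nth_rotate[of "j - 1" vs "Suc i"] by (simp add: w_def ws_def del: rotate_Suc)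
    moreover have "w j = vs ! ((i + 1) mod j)"
      using j j3 nth_rotate[of 0 vs "Suc i"] by (simp add: w_def ws_def del: rotate_Suc)
    ultimately have "w (j - 1) = vs ! i" "w j = vs ! ((i + 1) mod j)" .
    then show ?thesis using i(2) j3 by simp
  qed
  have in_xs: "w t \<in> set xs \<and> w (Suc t) \<in> set xs" if "t < j" "{w t, w (Suc t)} \<notin> E" for t
    using w_edge[OF that(1)] that(2) cycle_edges_subset[OF xs(2)] by blast
  \<comment> \<open>A maximal run \<open>w a, \<dots>, w b\<close> of old edges would join two vertices of \<open>xs\<close> by a short walk.\<close>
  have "\<exists>t<j. {w t, w (Suc t)} \<in> E"
  proof (rule ccontr)
    assume "\<not> ?thesis"
    then have "{w t, w (Suc t)} \<in> ?C" if "t < j" for t using w_edge that by blast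
    then have "is_cycle ?C j ws" using len dist j3 by (auto simp: is_cycle_def w_def)
    then show False using cycle_in_cycle[OF xs] neg by blast
  qed
  then obtain a where a: "a < j" "{w a, w (Suc a)} \<in> E" and amin: "\<And>t. t < a \<Longrightarrow> {w t, w (Suc t)} \<notin> E"
    by (subst (asm) exists_least_iff) (blast dest: order.strict_trans)
  have "\<exists>b. a < b \<and> b < j \<and> {w b, w (Suc b)} \<notin> E"
    using w_last a by (intro exI[of _ "j - 1"]) (cases "a = j - 1", auto)
  then obtain b where b: "a < b" "b < j" "{w b, w (Suc b)} \<notin> E"
    and bleast: "\<And>t. t < b \<Longrightarrow> \<not> (a < t \<and> t < j \<and> {w t, w (Suc t)} \<notin> E)"
    by (subst (asm) exists_least_iff) blast
  have bmin: "{w t, w (Suc t)} \<in> E" if "a < t" "t < b" for t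
    using bleast[OF that(2)] that b(2) by auto
  \<comment> \<open>The edge before position \<open>a\<close> is not old: for \<open>a = 0\<close>
    it is the closing edge, otherwise minimality of \<open>a\<close> applies.\<close>
  have "w a \<in> set xs"
  proof (cases a)
    case 0
    have "w a = w (Suc (j - 1))" using j3 0 by (simp add: w_def)
    then show ?thesis using in_xs[of "j - 1"] w_last j3 by simp
  next
    case (Suc a')
    then show ?thesis using in_xs[of a'] amin[of a'] a(1) by simp
  qed
  moreover have "w b \<in> set xs" using in_xs b by blast
  moreover have "w a \<noteq> w b" using a(1) b len dist by (simp add: w_def nth_eq_iff_index_eq)
  moreover have "(w a, w (a + (b - a))) \<in> near E ^^ (b - a)"
  proof (rule near_relpow_walk)
    fix t assume "t < b - a"
    then show "{w (a + t), w (Suc (a + t))} \<in> E" using a(2) bmin[of "a + t"] by (cases t) auto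
  qed
  then have "(w a, w b) \<in> near E ^^ g"
    using b \<open>j \<le> g\<close> by (intro near_relpow_mono[of "w a" "w b" "b - a" E g]) auto
  ultimately show False using far by blast
qed

section \<open>The lower bound\<close>

lemma finite_simple_graphs: "finite {E. simple_graph n E}"
proof -
  have "{{u, v} | u v. u \<noteq> v \<and> u < n \<and> v < n} \<subseteq> Pow {..<n}" by auto
  then have "finite {{u, v} | u v. u \<noteq> v \<and> u < n \<and> v < n}" by (rule finite_subset) simp
  then have "finite (Pow {{u, v} | u v. u \<noteq> v \<and> u < n \<and> v < n})" by simp
  moreover have "{E. simple_graph n E} = Pow {{u, v} | u v. u \<noteq> v \<and> u < n \<and> v < n}"
    by (auto simp: simple_graph_def)
  ultimately show ?thesis by simp
qed

lemma simple_graph_finite: "simple_graph n E \<Longrightarrow> finite E"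
proof -
  assume "simple_graph n E"
  then have "E \<subseteq> Pow {..<n}" by (auto simp: simple_graph_def)
  then show ?thesis by (rule finite_subset) simp
qed

lemma finite_neighbours:
  assumes "simple_graph n E" shows "finite {u. {u, v} \<in> E}"
  by (rule finite_subset[of _ "{..<n}"]) (use assms in \<open>auto simp: simple_graph_def doubleton_eq_iff\<close>)

lemma sum_degree_le:
  assumes "simple_graph n E"
  shows "(\<Sum>v<n. degree E v) \<le> 2 * card E"
proof -
  have fE: "finite E" by (rule simple_graph_finite[OF assms])
  have "(\<Sum>v<n. degree E v) = card (SIGMA v:{..<n}. {u. {u, v} \<in> E})"
    by (simp add: degree_def card_SigmaI finite_neighbours[OF assms])
  also have "\<dots> \<le> card (SIGMA e:E. e)"
  proof (rule card_inj_on_le[of "\<lambda>(v, u). ({u, v}, v)"])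
    show "inj_on (\<lambda>(v, u). ({u, v}, v)) (SIGMA v:{..<n}. {u. {u, v} \<in> E})"
      by (auto simp: inj_on_def doubleton_eq_iff)
    show "(\<lambda>(v, u). ({u, v}, v)) ` (SIGMA v:{..<n}. {u. {u, v} \<in> E}) \<subseteq> (SIGMA e:E. e)" by auto
    have "finite e" if "e \<in> E" for e using assms that by (auto simp: simple_graph_def)
    then show "finite (SIGMA e:E. e)" using fE by auto
  qed
  also have "\<dots> = (\<Sum>e\<in>E. card e)"
    using fE assms by (intro card_SigmaI) (auto simp: simple_graph_def)
  also have "\<dots> \<le> (\<Sum>e\<in>E. 2)"
    using assms by (intro sum_mono) (auto simp: simple_graph_def card_insert_if)
  finally show ?thesis by simp
qed

lemma finite_cycle_edge_sets:
  "simple_graph n E \<Longrightarrow> finite {cycle_edges r vs | vs. is_cycle E r vs}"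
  using finite_cycles[of n E r] by simp

lemma not_contains_cycle_empty: "\<not> contains_cycle {} j"
  by (auto simp: contains_cycle_def is_cycle_def intro!: exI[of _ 0])

text \<open>Distance keeps the new edges out of \<open>E\<close> and creates no forbidden cycle;
  degrees grow by at most 2, and only on \<open>xs\<close>. At most \<open>r\<close> edges come with
  at least one new copy, so the ratio of edges to copies stays bounded by \<open>r\<close>.\<close>

lemma add_far_cycle:
  assumes E: "simple_graph n E" "\<forall>v. degree E v \<le> D" "card E \<le> r * count_cycles E r"
    and nocyc: "\<forall>j\<in>F. \<not> contains_cycle E j" and F: "F \<subseteq> {..g}" "r \<notin> F"
    and xs: "distinct xs" "length xs = r" "r \<ge> 3" and lt: "set xs \<subseteq> {..<n}"
    and low: "\<And>x. x \<in> set xs \<Longrightarrow> degree E x + 2 \<le> D"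
    and g: "g \<ge> 1"
    and far: "\<And>x y. x \<in> set xs \<Longrightarrow> y \<in> set xs \<Longrightarrow> x \<noteq> y \<Longrightarrow> (x, y) \<notin> near E ^^ g"
  defines "E' \<equiv> E \<union> cycle_edges r xs"
  shows "simple_graph n E'" "\<forall>v. degree E' v \<le> D" "card E' \<le> r * count_cycles E' r"
    "\<forall>j\<in>F. \<not> contains_cycle E' j" "card E < card E'"
proof -
  let ?C = "cycle_edges r xs"
  have C_pairs: "\<exists>x y. e = {x, y} \<and> x \<noteq> y \<and> x \<in> set xs \<and> y \<in> set xs" if e: "e \<in> ?C" for e
  proof -
    obtain i where i: "i < r" "e = {xs ! i, xs ! ((i + 1) mod r)}" using e by (auto simp: cycle_edges_def)
    have m: "(i + 1) mod r < r" using i(1) by auto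
    have "i \<noteq> (i + 1) mod r" using i(1) xs(3) by (cases "i + 1 = r") auto
    then have "xs ! i \<noteq> xs ! ((i + 1) mod r)" using xs i m by (simp add: nth_eq_iff_index_eq)
    moreover have "xs ! i \<in> set xs" "xs ! ((i + 1) mod r) \<in> set xs" using xs(2) i m by (auto intro: nth_mem)
    ultimately show ?thesis using i(2) by blast
  qed
  have new: "e \<notin> E" if e: "e \<in> ?C" for e
  proof
    assume "e \<in> E"
    obtain x y where xy: "e = {x, y}" "x \<noteq> y" "x \<in> set xs" "y \<in> set xs" using C_pairs[OF e] by blast
    then have "(x, y) \<in> near E ^^ 1" using \<open>e \<in> E\<close> by (simp add: near_def)
    then show False using far[OF xy(3,4,2)] near_relpow_mono[of x y 1 E g] g by blast
  qed
  show simple': "simple_graph n E'"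
    unfolding simple_graph_def
  proof
    fix e assume "e \<in> E'"
    then consider "e \<in> E" | "e \<in> ?C" by (auto simp: E'_def)
    then show "e \<in> {{u, v} | u v. u \<noteq> v \<and> u < n \<and> v < n}"
    proof cases
      case 1
      then show ?thesis using E(1) by (auto simp: simple_graph_def)
    next
      case 2
      then obtain x y where "e = {x, y}" "x \<noteq> y" "x \<in> set xs" "y \<in> set xs" using C_pairs by blast
      then show ?thesis using lt by blast
    qed
  qed
  have C_img: "?C = (\<lambda>i. {xs ! i, xs ! ((i + 1) mod r)}) ` {..<r}" by (auto simp: cycle_edges_def)
  then have finC: "finite ?C" and cardC: "card ?C \<le> r"
    using card_image_le[of "{..<r}" "\<lambda>i. {xs ! i, xs ! ((i + 1) mod r)}"] by auto
  have finE: "finite E" by (rule simple_graph_finite[OF E(1)])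
  have xs_cycle: "is_cycle E' r xs"
    using xs unfolding is_cycle_def E'_def by (auto simp: cycle_edges_def)
  have C0: "{xs ! 0, xs ! (1 mod r)} \<in> ?C" using xs(3) by (auto simp: cycle_edges_def intro!: exI[of _ 0])
  then show "card E < card E'"
    using finE finC new unfolding E'_def by (intro psubset_card_mono) auto
  show "card E' \<le> r * count_cycles E' r"
  proof -
    have "{cycle_edges r vs | vs. is_cycle E r vs} \<subset> {cycle_edges r vs | vs. is_cycle E' r vs}"
    proof
      show "{cycle_edges r vs | vs. is_cycle E r vs} \<subseteq> {cycle_edges r vs | vs. is_cycle E' r vs}"
        unfolding is_cycle_def E'_def by blast
      have "?C \<notin> {cycle_edges r vs | vs. is_cycle E r vs}"
      proof
        assume "?C \<in> {cycle_edges r vs | vs. is_cycle E r vs}"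
        then obtain vs where vs: "?C = cycle_edges r vs" "is_cycle E r vs" by blast
        have "?C \<subseteq> E" unfolding vs(1) using vs(2) by (auto simp: cycle_edges_def is_cycle_def)
        then show False using C0 new by blast
      qed
      moreover have "?C \<in> {cycle_edges r vs | vs. is_cycle E' r vs}" using xs_cycle by blast
      ultimately show "{cycle_edges r vs | vs. is_cycle E r vs} \<noteq> {cycle_edges r vs | vs. is_cycle E' r vs}"
        by blast
    qed
    then have "count_cycles E r < count_cycles E' r"
      unfolding count_cycles_def by (rule psubset_card_mono[OF finite_cycle_edge_sets[OF simple']])
    then have "r * (count_cycles E r + 1) \<le> r * count_cycles E' r" by (intro mult_le_mono2) simp
    moreover have "card E' \<le> card E + card ?C" unfolding E'_def by (rule card_Un_le)
    ultimately show ?thesis using E(3) cardC by simp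
  qed
  show "\<forall>v. degree E' v \<le> D"
  proof
    fix v
    have "{u. {u, v} \<in> E'} = {u. {u, v} \<in> E} \<union> {u. {u, v} \<in> ?C}" by (auto simp: E'_def)
    then have deg: "degree E' v \<le> degree E v + card {u. {u, v} \<in> ?C}"
      unfolding degree_def by (simp add: card_Un_le)
    show "degree E' v \<le> D"
    proof (cases "v \<in> set xs")
      case True
      then obtain a where a: "a < r" "v = xs ! a" using xs(2) by (auto simp: in_set_conv_nth)
      have "{u. {u, v} \<in> ?C} \<subseteq> {xs ! ((a + 1) mod r), xs ! ((a + r - 1) mod r)}"
        using cycle_edges_nbrs[OF xs(1,2) a(1)] a(2) by blast
      then have "card {u. {u, v} \<in> ?C} \<le> card {xs ! ((a + 1) mod r), xs ! ((a + r - 1) mod r)}"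
        by (intro card_mono) auto
      also have "\<dots> \<le> 2" by (simp add: card_insert_if)
      finally show ?thesis using deg low[OF True] by simp
    next
      case False
      then have "{u. {u, v} \<in> ?C} = {}" using cycle_edges_subset[OF xs(2)] by blast
      then show ?thesis using deg E(2) by (metis add.right_neutral card.empty order_trans)
    qed
  qed
  show "\<forall>j\<in>F. \<not> contains_cycle E' j"
  proof
    fix j assume j: "j \<in> F"
    then have "j \<le> g" "j \<noteq> r" using F by auto
    then show "\<not> contains_cycle E' j"
      using cycle_after_adding_far_cycle[OF xs far] nocyc j unfolding contains_cycle_def E'_def by blast
  qed
qed

text \<open>As edges are at most \<open>r\<close> times the copies, it suffices to find many edges.
  In an edge-maximal graph fewer than \<open>r\<close> low-degree vertices can be pairwise far
  apart, so few balls of radius \<open>g\<close> cover all of them. The subtractions truncate, which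
  makes the bound trivial for small \<open>n\<close> or \<open>D\<close>.\<close>

lemma exists_many_cycles_graph:
  assumes F: "F \<subseteq> {..g}" "r \<notin> F" and r: "r \<ge> 3" and g: "g \<ge> 1"
  shows "\<exists>E. simple_graph n E \<and> (\<forall>j\<in>F. \<not> contains_cycle E j) \<and>
    (n - r * (D + 1) ^ g) * (D - 1) \<le> 2 * r * count_cycles E r"
proof -
  define good where "good E \<longleftrightarrow> simple_graph n E \<and> (\<forall>v. degree E v \<le> D) \<and>
    card E \<le> r * count_cycles E r \<and> (\<forall>j\<in>F. \<not> contains_cycle E j)" for E
  have fin: "finite {E. good E}"
    by (rule finite_subset[OF _ finite_simple_graphs[of n]]) (auto simp: good_def)
  have ne: "good {}" by (auto simp: good_def simple_graph_def degree_def not_contains_cycle_empty)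
  have "Max (card ` {E. good E}) \<in> card ` {E. good E}" using fin ne by (intro Max_in) auto
  then obtain E where E: "good E" and cardE: "card E = Max (card ` {E. good E})" by auto
  have Emax: "card E' \<le> card E" if "good E'" for E'
    unfolding cardE using fin that by (intro Max_ge) auto
  have simple: "simple_graph n E" and deg: "\<forall>v. degree E v \<le> D"
    and cE: "card E \<le> r * count_cycles E r" and nocyc: "\<forall>j\<in>F. \<not> contains_cycle E j"
    using E by (auto simp: good_def)
  define L where "L = {v. v < n \<and> degree E v + 2 \<le> D}"
  define far where "far S \<longleftrightarrow> S \<subseteq> L \<and> (\<forall>x\<in>S. \<forall>y\<in>S. x \<noteq> y \<longrightarrow> (x, y) \<notin> near E ^^ g)" for S
  have finL: "finite L" by (simp add: L_def)
  have finS: "finite {S. far S}" by (rule finite_subset[of _ "Pow L"]) (auto simp: far_def finL)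
  have "far {}" by (simp add: far_def)
  then have "Max (card ` {S. far S}) \<in> card ` {S. far S}" using finS by (intro Max_in) auto
  then obtain S where S: "far S" and cardS: "card S = Max (card ` {S. far S})" by auto
  have Smax: "card S' \<le> card S" if "far S'" for S'
    unfolding cardS using finS that by (intro Max_ge) auto
  have finS: "finite S" using S finL finite_subset unfolding far_def by blast
  \<comment> \<open>With \<open>r\<close> such vertices, a new cycle through them would contradict
    the maximality of \<open>E\<close>.\<close>
  have Sr: "card S < r"
  proof (rule ccontr)
    assume "\<not> ?thesis"
    then obtain T where T: "T \<subseteq> S" "card T = r" "finite T"
      using obtain_subset_with_card_n[of r S] by (auto simp: not_less)
    obtain xs where xs: "set xs = T" "distinct xs" using finite_distinct_list[OF T(3)] by blast
    have len: "length xs = r" using xs T(2) distinct_card[of xs] by simp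
    have "good (E \<union> cycle_edges r xs) \<and> card E < card (E \<union> cycle_edges r xs)"
      unfolding good_def
      using add_far_cycle[OF simple deg cE nocyc F xs(2) len r _ _ g] T(1) S xs(1)
      unfolding far_def L_def by blast
    then show False using Emax by force
  qed
  \<comment> \<open>A low-degree vertex outside all balls could be added to \<open>S\<close>,
    contradicting its maximal size.\<close>
  have "L \<subseteq> (\<Union>x\<in>S. (near E ^^ g) `` {x})"
  proof
    fix w assume w: "w \<in> L"
    show "w \<in> (\<Union>x\<in>S. (near E ^^ g) `` {x})"
    proof (rule ccontr)
      assume neg: "w \<notin> (\<Union>x\<in>S. (near E ^^ g) `` {x})"
      have refl: "(w, w) \<in> near E ^^ g" using near_relpow_mono[of w w 0 E g] by simp
      then have "w \<notin> S" using neg by blast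
      have "(w, x) \<notin> near E ^^ g" "(x, w) \<notin> near E ^^ g" if "x \<in> S" for x
        using neg that symD[OF sym_relpow[OF sym_near]] by blast+
      then have "far (insert w S)" using S w by (auto simp: far_def)
      then show False using Smax[of "insert w S"] \<open>w \<notin> S\<close> finS by simp
    qed
  qed
  then have "card L \<le> card (\<Union>x\<in>S. (near E ^^ g) `` {x})"
    using finS card_near_ball[of E D g] finite_neighbours[OF simple] deg by (intro card_mono) auto
  also have "\<dots> \<le> (\<Sum>x\<in>S. card ((near E ^^ g) `` {x}))" by (rule card_UN_le[OF finS])
  also have "\<dots> \<le> (\<Sum>x\<in>S. (D + 1) ^ g)"
    using card_near_ball[of E D g] finite_neighbours[OF simple] deg by (intro sum_mono) auto
  also have "\<dots> \<le> r * (D + 1) ^ g" using Sr by simp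
  finally have cardL: "card L \<le> r * (D + 1) ^ g" .
  have "(n - r * (D + 1) ^ g) * (D - 1) \<le> card ({..<n} - L) * (D - 1)"
  proof -
    have "card ({..<n} - L) = n - card L" by (subst card_Diff_subset[OF finL]) (auto simp: L_def)
    then show ?thesis using cardL by (intro mult_right_mono) auto
  qed
  also have "\<dots> = (\<Sum>v\<in>{..<n} - L. D - 1)" by simp
  also have "\<dots> \<le> (\<Sum>v\<in>{..<n} - L. degree E v)" by (intro sum_mono) (auto simp: L_def)
  also have "\<dots> \<le> (\<Sum>v<n. degree E v)" by (intro sum_mono2) auto
  also have "\<dots> \<le> 2 * card E" by (rule sum_degree_le[OF simple])
  also have "\<dots> \<le> 2 * r * count_cycles E r" using cE by simp
  finally show ?thesis using simple nocyc by blast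
qed

section \<open>The extremal number as an attained maximum\<close>

lemma finite_ex_cycle_set:
  "finite {count_cycles E h | E. simple_graph n E \<and> (\<forall>j\<in>F. \<not> contains_cycle E j)}"
  using finite_simple_graphs[of n] by simp

lemma ex_cycle_ge:
  assumes "simple_graph n E" "\<forall>j\<in>F. \<not> contains_cycle E j"
  shows "count_cycles E h \<le> ex_cycle n h F"
  unfolding ex_cycle_def using assms by (intro Max_ge finite_ex_cycle_set) auto

lemma ex_cycle_attained:
  "\<exists>E. simple_graph n E \<and> (\<forall>j\<in>F. \<not> contains_cycle E j) \<and> ex_cycle n h F = count_cycles E h"
proof -
  have "simple_graph n {} \<and> (\<forall>j\<in>F. \<not> contains_cycle {} j)"
    by (simp add: not_contains_cycle_empty simple_graph_def)
  then have "{count_cycles E h | E. simple_graph n E \<and> (\<forall>j\<in>F. \<not> contains_cycle E j)} \<noteq> {}" by blast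
  from Max_in[OF finite_ex_cycle_set this] show ?thesis unfolding ex_cycle_def by blast
qed

theorem theorem13:
  fixes k l :: nat
  assumes "k > l" and "l \<ge> 2"
  shows "(\<lambda>n. real (ex_cycle n (2*l+1) ({3..2*l} \<union> {2*k})))
           \<in> \<Omega>(\<lambda>n. real n powr (1 + 1 / (2 * real k + 1))) \<and>
         (\<lambda>n. real (ex_cycle n (2*l+1) ({3..2*l} \<union> {2*k})))
           \<in> O(\<lambda>n. real n powr (1 + real l / (real l + 1)))"
proof
  let ?r = "2 * l + 1" and ?F = "{3..2*l} \<union> {2*k}"
  show "(\<lambda>n. real (ex_cycle n ?r ?F)) \<in> O(\<lambda>n. real n powr (1 + real l / (real l + 1)))"
  proof (rule bigoI[of _ "real (2 * l + 1) * (4 * real k + 2)\<^sup>2"])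
    show "\<forall>\<^sub>F n in sequentially. norm (real (ex_cycle n ?r ?F)) \<le>
        real (2 * l + 1) * (4 * real k + 2)\<^sup>2 * norm (real n powr (1 + real l / (real l + 1)))"
      using eventually_gt_at_top[of "0::nat"]
    proof eventually_elim
      case (elim n)
      obtain E where E: "simple_graph n E" "\<forall>j\<in>?F. \<not> contains_cycle E j" "ex_cycle n ?r ?F = count_cycles E ?r"
        using ex_cycle_attained by blast
      then have "girth_graph E n k l" using assms by unfold_locales auto
      from count_cycles_upper[OF this elim] show ?case using E(3) by simp
    qed
  qed
  show "(\<lambda>n. real (ex_cycle n ?r ?F)) \<in> \<Omega>(\<lambda>n. real n powr (1 + 1 / (2 * real k + 1)))"
  \<comment> \<open>The constant combines at least \<open>n / 2\<close> vertices of degree at least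
    \<open>x n\<close> with the factor \<open>2 * r\<close> between the degree sum and the number of
    copies.\<close>
  proof (rule landau_omega.bigI[of "1 / (4 * real ?r)"])
    define x where "x n = real n powr (1 / (2 * real k + 1))" for n :: nat
    \<comment> \<open>Once \<open>x n\<close> exceeds this threshold, at most half of the vertices
      are exceptional; the maximum with 1 also secures \<open>x n \<ge> 1\<close>.\<close>
    define B where "B = max 1 (2 * real ?r * 4 ^ (2 * k))"
    have B: "B \<ge> 1" by (simp add: B_def)
    have exponent: "real (2 * k + 1) * (1 / (2 * real k + 1)) = 1" by simp
    have "\<forall>\<^sub>F n in sequentially. B ^ (2 * k + 1) \<le> real n"
      using filterlim_real_sequentially by (simp only: filterlim_at_top)
    then have "\<forall>\<^sub>F n in sequentially. B \<le> x n"
    proof eventually_elim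
      case (elim n)
      have "B = (B ^ (2 * k + 1)) powr (1 / (2 * real k + 1))"
        using B exponent by (simp only: powr_realpow[symmetric] powr_powr) simp
      also have "\<dots> \<le> x n" unfolding x_def using elim B by (intro powr_mono2) auto
      finally show ?case .
    qed
    then show "\<forall>\<^sub>F n in sequentially. norm (real (ex_cycle n ?r ?F)) \<ge>
        1 / (4 * real ?r) * norm (real n powr (1 + 1 / (2 * real k + 1)))"
      using eventually_gt_at_top[of "0::nat"]
    proof eventually_elim
      case (elim n)
      have x1: "x n \<ge> 1" and xbig: "2 * real ?r * 4 ^ (2 * k) \<le> x n" using elim by (auto simp: B_def)
      \<comment> \<open>The extra 1 gives \<open>D - 1 \<ge> x n\<close>, while
        \<open>D + 1 \<le> x n + 3 \<le> 4 * x n\<close>.\<close>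
      define D where "D = nat \<lceil>x n\<rceil> + 1"
      have D: "x n \<le> real (D - 1)" "real (D + 1) \<le> 4 * x n"
        using x1 unfolding D_def by (auto, linarith+)
      have xpow: "x n ^ (2 * k + 1) = real n"
      proof -
        have "x n ^ (2 * k + 1) = x n powr real (2 * k + 1)" using x1 by (intro powr_realpow[symmetric]) simp
        also have "\<dots> = real n powr (1 / (2 * real k + 1) * real (2 * k + 1))" by (simp only: x_def powr_powr)
        also have "\<dots> = real n" using exponent elim by (simp only: mult.commute) simp
        finally show ?thesis .
      qed
      obtain E where E: "simple_graph n E" "\<forall>j\<in>?F. \<not> contains_cycle E j"
        and cnt: "(n - ?r * (D + 1) ^ (2 * k)) * (D - 1) \<le> 2 * ?r * count_cycles E ?r"
      proof -
        \<comment> \<open>The radius \<open>2 * k\<close> is the longest forbidden length;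
          \<open>?r\<close> is odd and exceeds \<open>2 * l\<close>, so it is not forbidden.\<close>
        have "?F \<subseteq> {..2 * k}" "?r \<notin> ?F" "3 \<le> ?r" "1 \<le> 2 * k"
          using assms by auto
        from exists_many_cycles_graph[OF this, of n D] show thesis using that by blast
      qed
      have "real (?r * (D + 1) ^ (2 * k)) = real ?r * real (D + 1) ^ (2 * k)"
        by (simp only: of_nat_mult of_nat_power)
      also have "\<dots> \<le> real ?r * (4 * x n) ^ (2 * k)" using D(2) by (intro mult_left_mono power_mono) auto
      also have "\<dots> = (real ?r * 4 ^ (2 * k)) * x n ^ (2 * k)"
        by (simp only: power_mult_distrib mult.assoc)
      \<comment> \<open>One factor \<open>x n\<close> absorbs the constant, and the resulting power
        \<open>2 * k + 1\<close> of \<open>x n\<close> is \<open>n\<close>.\<close>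
      also have "\<dots> \<le> (x n / 2) * x n ^ (2 * k)"
      proof (rule mult_right_mono)
        show "real ?r * 4 ^ (2 * k) \<le> x n / 2" using xbig by linarith
      qed (use x1 in simp)
      also have "\<dots> = real n / 2" using xpow by simp
      finally have half: "real n / 2 \<le> real (n - ?r * (D + 1) ^ (2 * k))" by linarith
      have "real n / 2 * x n \<le> real (n - ?r * (D + 1) ^ (2 * k)) * real (D - 1)"
        using half D(1) x1 by (intro mult_mono) auto
      also have "\<dots> \<le> real (2 * ?r * count_cycles E ?r)"
        using cnt by (simp only: of_nat_mult[symmetric] of_nat_le_iff)
      also have "\<dots> = 2 * real ?r * real (count_cycles E ?r)" by (simp only: of_nat_mult of_nat_numeral)
      also have "\<dots> \<le> 2 * real ?r * real (ex_cycle n ?r ?F)"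
        using ex_cycle_ge[OF E] by (intro mult_left_mono) auto
      finally have "real n * x n \<le> real (ex_cycle n ?r ?F) * (4 * real ?r)" by (simp add: algebra_simps)
      then have "real n * x n / (4 * real ?r) \<le> real (ex_cycle n ?r ?F)"
        by (subst pos_divide_le_eq) simp_all
      moreover have "norm (real n powr (1 + 1 / (2 * real k + 1))) = real n * x n"
        using elim by (simp add: x_def powr_add)
      ultimately show ?case by (simp only: real_norm_def abs_of_nat times_divide_eq_left mult_1)
    qed
  qed simp
qed

end
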